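(* Let $C$ be a binary doubly even self-dual code of length $96$ with minimum weight $16$, and let $\ell\in\mathcal{L}$, where $\mathcal{L}=\{\ell\in\mathbb{Z}\mid 16\le\ell\le 80,\ \ell\equiv0\pmod 4\}$. Assume that $C_\ell$ is non-empty and is a combinatorial $t$-design, where $t$ is a positive integer with $t\le\ell$. Then the following statements hold: (1) If $t=2$ and $\ell\ne20,76$, then every shell of $C$ is a combinatorial $2$-design. (2) If $t\ge3$ and $\ell\neq20,48,76$, then every shell of $C$ is a combinatorial $t$-design. (3) We have $$t\le\begin{cases}7&\text{if }\ell=48,\\ 5&\text{if }\ell=20,76,\\ 4&\text{otherwise.}\end{cases}$$
   Context: A binary linear code $C$ of length $n$ is a linear subspace of $\mathbb{F}_2^n$; it is self-dual if $C=C^\perp$ with respect to $(x,y)=\sum_i x_iy_i$, and doubly even if all weights are divisible by $4$, where $\mathrm{supp}(x)=\{i\mid x_i\ne0\}$ and $\mathrm{wt}(x)=|\mathrm{supp}(x)|$. The minimum weight is the smallest weight of a nonzero codeword. Put $C_\ell=\{c\in C\mid \mathrm{wt}(c)=\ell\}$; it is called a shell of $C$ when it is non-empty. A pair $(\Omega,\mathcal{B})$, with $\Omega$ a finite set and $\mathcal{B}$ a set (no repeated blocks) of $k$-element subsets of $\Omega$ (blocks), is a combinatorial $t$-design if there is a number $\lambda$ such that any $t$ points of $\Omega$ are contained in precisely $\lambda$ blocks. $C_\ell$ is said to be a combinatorial $t$-design if $(\{1,\dots,n\},\{\mathrm{supp}(x)\mid x\in C_\ell\})$ is one. *)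

theory Defs
  imports "HOL-Analysis.Cartesian_Space" "HOL-Library.Z2"
begin

text \<open>
  Words of length \<open>n\<close> over the binary field are the vectors of type \<open>bit ^ 'n\<close>, where \<open>'n\<close> is a
  finite index type with \<open>CARD('n) = n\<close>; the coordinate positions \<open>{1,\<dots>,n}\<close> are thus the elements
  of \<open>UNIV :: 'n set\<close>. A binary linear code is a set \<open>C\<close> of such words with \<open>vec.subspace C\<close>.
\<close>

definition bilin :: "bit ^ 'n::finite \<Rightarrow> bit ^ 'n \<Rightarrow> bit" where
  "bilin x y = (\<Sum>i\<in>UNIV. x $ i * y $ i)"

definition dual_code :: "(bit ^ 'n::finite) set \<Rightarrow> (bit ^ 'n) set" where
  "dual_code C = {x. \<forall>y\<in>C. bilin x y = 0}"

definition self_dual :: "(bit ^ 'n::finite) set \<Rightarrow> bool" where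
  "self_dual C \<longleftrightarrow> vec.subspace C \<and> C = dual_code C"

definition supp :: "bit ^ 'n::finite \<Rightarrow> 'n set" where
  "supp x = {i. x $ i \<noteq> 0}"

definition wt :: "bit ^ 'n::finite \<Rightarrow> nat" where
  "wt x = card (supp x)"

definition doubly_even :: "(bit ^ 'n::finite) set \<Rightarrow> bool" where
  "doubly_even C \<longleftrightarrow> (\<forall>c\<in>C. 4 dvd wt c)"

text \<open>Only meaningful for codes that contain a nonzero word.\<close>

definition min_weight :: "(bit ^ 'n::finite) set \<Rightarrow> nat" where
  "min_weight C = Min (wt ` (C - {0}))"

definition words_of_weight :: "(bit ^ 'n::finite) set \<Rightarrow> nat \<Rightarrow> (bit ^ 'n) set" where
  "words_of_weight C l = {c \<in> C. wt c = l}"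

definition is_shell :: "(bit ^ 'n::finite) set \<Rightarrow> (bit ^ 'n) set \<Rightarrow> bool" where
  "is_shell C S \<longleftrightarrow> S \<noteq> {} \<and> (\<exists>l. S = words_of_weight C l)"

definition comb_design :: "nat \<Rightarrow> 'a set \<Rightarrow> 'a set set \<Rightarrow> bool" where
  "comb_design t \<Omega> B \<longleftrightarrow>
     finite \<Omega> \<and>
     (\<exists>k. \<forall>b\<in>B. b \<subseteq> \<Omega> \<and> card b = k) \<and>
     (\<exists>\<mu>::nat. \<forall>T. T \<subseteq> \<Omega> \<and> card T = t \<longrightarrow> card {b \<in> B. T \<subseteq> b} = \<mu>)"

definition words_design :: "nat \<Rightarrow> (bit ^ 'n::finite) set \<Rightarrow> bool" where
  "words_design t S \<longleftrightarrow> comb_design t UNIV (supp ` S)"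

definition weights_L :: "nat set" where
  "weights_L = {l. 16 \<le> l \<and> l \<le> 80 \<and> l mod 4 = 0}"

end

theory Submission
  imports Defs "HOL-Computational_Algebra.Polynomial"
begin

text \<open>
  Write \<open>u = y^4\<close>. For disjoint pairs of points \<open>(a_1, b_1), \<dots>, (a_d, b_d)\<close> the product of
  the differences \<open>[a_i \<in> X] - [b_i \<in> X]\<close> is a harmonic function of degree \<open>d\<close> on subsets
  \<open>X\<close>, and these products span all of them. A family of blocks of constant size on
  sufficiently many points is therefore a \<open>t\<close>-design exactly when the products with
  \<open>1, \<dots>, t\<close> factors all sum to zero over it; one direction is \<open>comb_design_pair_sum_eq_0\<close>,
  and \<open>comb_design_SucI\<close> raises the strength by one.

  Fix such a product with \<open>1 \<le> d \<le> 5\<close> and let \<open>S_l\<close> be its sum over the words of weight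
  \<open>l\<close>. The words with a nonzero product have weight \<open>16 + 4 * j\<close> with \<open>j \<le> 16\<close>. Poisson
  summation over the self-dual code gives a MacWilliams identity for the \<open>S_l\<close>
  (\<open>macwilliams_pairs\<close>), which says that \<open>y^(16 - d) * g(u)\<close> with
  \<open>g(u) = \<Sum>j. S_(16 + 4 j) u^j\<close> is fixed, as a binary form and up to a scalar, by the
  substitution of \<open>(1 - y) / (1 + y)\<close> for \<open>y\<close>. The substitution maps the zero of order
  \<open>16 - d\<close> at \<open>y = 0\<close> to \<open>y = 1\<close>; so \<open>(u - 1)^(16 - d)\<close> divides \<open>g\<close>, and the quotient has
  degree at most \<open>d\<close> and is itself invariant (\<open>invariant_poly_quotient\<close>). For \<open>d \<le> 5\<close> the
  invariance determines this quotient up to a scalar (\<open>reduced_invariant_eq\<close>), and for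
  \<open>d = 1\<close> it is zero. Hence all \<open>S_l\<close> are multiples of explicit integers by one and the
  same scalar. If \<open>d \<ge> 2\<close>, these integers vanish only for \<open>l = 20, 76\<close> if \<open>d = 2\<close> and for
  \<open>l = 48\<close> if \<open>d = 3\<close> or \<open>d = 5\<close>. At any other weight, a single design condition makes the
  scalar zero, which yields the condition for every shell (\<open>comb_design_all_shells\<close>).

  The same factorization with \<open>d = 0\<close>, applied to the difference of the weight enumerator
  and an explicit invariant polynomial, determines all the numbers \<open>A_l\<close> of words of
  weight \<open>l\<close> from \<open>A_16\<close> (\<open>weight_enumerator\<close>). In particular
  \<open>A_20 = A_76 = 3217056 - 16 * A_16\<close>, so that \<open>1 \<le> A_16 \<le> 201066\<close>.

  The bounds on \<open>t\<close> come from divisibility: in a \<open>t\<close>-design of \<open>A\<close> blocks of size \<open>k\<close> on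
  \<open>96\<close> points, the number \<open>A * k (k - 1) \<dots> (k - t + 1)\<close> is a multiple of
  \<open>96 * 95 * \<dots> * (96 - t + 1)\<close>. Outside the weights \<open>20, 48, 76\<close> a \<open>5\<close>-design makes \<open>C_16\<close>
  a \<open>5\<close>-design, and then \<open>A_16\<close> is a multiple of a number above \<open>201066\<close>. Likewise \<open>A_20\<close>
  and \<open>A_76\<close> are too small for \<open>6\<close>-designs. If \<open>C_48\<close> were an \<open>8\<close>-design, the congruences
  for strengths \<open>6\<close> and \<open>8\<close> would leave \<open>196726\<close> as the only possible value of \<open>A_16\<close> in
  its range, which is excluded because \<open>C_16\<close> is a \<open>1\<close>-design.
\<close>

section \<open>Designs and signed sums over pairs of points\<close>

definition uniform_blocks :: "nat \<Rightarrow> 'a set set \<Rightarrow> bool" where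
  "uniform_blocks k B \<longleftrightarrow> (\<forall>X\<in>B. card X = k)"

definition pair_sign :: "('a \<times> 'a) list \<Rightarrow> 'a set \<Rightarrow> real" where
  "pair_sign P X = (\<Prod>(a, b)\<leftarrow>P. of_bool (a \<in> X) - of_bool (b \<in> X))"

definition pair_points :: "('a \<times> 'a) list \<Rightarrow> 'a set" where
  "pair_points P = fst ` set P \<union> snd ` set P"

definition disjoint_pairs :: "('a \<times> 'a) list \<Rightarrow> bool" where
  "disjoint_pairs P \<longleftrightarrow> distinct (map fst P @ map snd P)"

text \<open>
  The points in \<open>T\<close> are additionally required to lie in the block. This interpolates
  between counting the blocks through \<open>T\<close> (no pairs) and the pure signed sum (\<open>T\<close> empty),
  which is what the induction on the strength runs over.
\<close>

definition pair_sum :: "'a set set \<Rightarrow> ('a \<times> 'a) list \<Rightarrow> 'a set \<Rightarrow> real" where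
  "pair_sum B P T = (\<Sum>X\<in>B. pair_sign P X * of_bool (T \<subseteq> X))"

lemma pair_sign_Nil [simp]: "pair_sign [] X = 1"
  by (simp add: pair_sign_def)

lemma pair_sign_Cons [simp]:
  "pair_sign ((a, b) # P) X = (of_bool (a \<in> X) - of_bool (b \<in> X)) * pair_sign P X"
  by (simp add: pair_sign_def)

lemma pair_points_Nil [simp]: "pair_points [] = {}"
  by (simp add: pair_points_def)

lemma pair_points_Cons [simp]: "pair_points ((a, b) # P) = insert a (insert b (pair_points P))"
  by (auto simp: pair_points_def)

lemma finite_pair_points [simp]: "finite (pair_points P)"
  by (simp add: pair_points_def)

lemma disjoint_pairs_Nil [simp]: "disjoint_pairs []"
  by (simp add: disjoint_pairs_def)

lemma disjoint_pairs_Cons [simp]: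
  "disjoint_pairs ((a, b) # P) \<longleftrightarrow>
     a \<noteq> b \<and> a \<notin> pair_points P \<and> b \<notin> pair_points P \<and> disjoint_pairs P"
  by (auto simp: disjoint_pairs_def pair_points_def)

lemma card_pair_points: "disjoint_pairs P \<Longrightarrow> card (pair_points P) = 2 * length P"
  by (induction P) auto

text \<open>
  A block with nonzero sign contains exactly one point of each pair.
\<close>

lemma card_Int_pair_points:
  assumes "disjoint_pairs P" and "pair_sign P X \<noteq> 0"
  shows "card (X \<inter> pair_points P) = length P"
  using assms
proof (induction P)
  case (Cons p P)
  obtain a b where p: "p = (a, b)" by force
  from Cons.prems have IH: "card (X \<inter> pair_points P) = length P"
    and new: "a \<notin> pair_points P" "b \<notin> pair_points P"
    and one: "a \<in> X \<longleftrightarrow> b \<notin> X"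
    using Cons.IH by (auto simp: p)
  show ?case
  proof (cases "a \<in> X")
    case True
    then have "X \<inter> pair_points (p # P) = insert a (X \<inter> pair_points P)"
      using one by (auto simp: p)
    then show ?thesis using IH new by simp
  next
    case False
    then have "X \<inter> pair_points (p # P) = insert b (X \<inter> pair_points P)"
      using one by (auto simp: p)
    then show ?thesis using IH new by simp
  qed
qed simp

lemma real_card_Compl: "real (card (- A)) = real CARD('a) - card A" for A :: "'a::finite set"
  by (simp add: Compl_eq_Diff_UNIV card_Diff_subset of_nat_diff card_mono)

lemma pair_sum_Cons:
  "pair_sum B ((a, b) # P) T = pair_sum B P (insert a T) - pair_sum B P (insert b T)"
  unfolding pair_sum_def sum_subtractf [symmetric]
  by (rule sum.cong) (auto simp: of_bool_def)

lemma pair_sum_Nil: "finite B \<Longrightarrow> pair_sum B [] T = real (card {X\<in>B. T \<subseteq> X})"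
  unfolding pair_sum_def by (simp add: of_bool_def sum.If_cases Int_def)

text \<open>
  A block that contains \<open>T\<close> and has nonzero sign has \<open>card T + length P\<close> of its \<open>k\<close> points
  in \<open>T\<close> and on the pairs, so it is counted once for each of the remaining ones.
\<close>

lemma sum_pair_sum_insert:
  fixes B :: "'a::finite set set"
  assumes "uniform_blocks k B" and "disjoint_pairs P" and "T \<inter> pair_points P = {}"
  shows "(\<Sum>x\<in>- (T \<union> pair_points P). pair_sum B P (insert x T))
           = (real k - card T - length P) * pair_sum B P T"
proof -
  have "(\<Sum>x\<in>- (T \<union> pair_points P). pair_sum B P (insert x T))
      = (\<Sum>X\<in>B. \<Sum>x\<in>- (T \<union> pair_points P). pair_sign P X * of_bool (insert x T \<subseteq> X))"
    unfolding pair_sum_def by (rule sum.swap)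
  also have "\<dots> = (\<Sum>X\<in>B. (real k - card T - length P) * (pair_sign P X * of_bool (T \<subseteq> X)))"
  proof (rule sum.cong [OF refl])
    fix X assume "X \<in> B"
    show "(\<Sum>x\<in>- (T \<union> pair_points P). pair_sign P X * of_bool (insert x T \<subseteq> X))
        = (real k - card T - length P) * (pair_sign P X * of_bool (T \<subseteq> X))"
    proof (cases "pair_sign P X \<noteq> 0 \<and> T \<subseteq> X")
      case True
      let ?Q = "X \<inter> pair_points P"
      have "(\<Sum>x\<in>- (T \<union> pair_points P). of_bool (insert x T \<subseteq> X))
          = real (card (- (T \<union> pair_points P) \<inter> X))"
        using True by (simp add: of_bool_def sum.If_cases Int_def)
      also have "- (T \<union> pair_points P) \<inter> X = X - (T \<union> ?Q)"
        by auto
      also have "real (card (X - (T \<union> ?Q))) = real (card X) - card (T \<union> ?Q)"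
        using True by (subst card_Diff_subset) (auto simp: of_nat_diff card_mono)
      also have "card (T \<union> ?Q) = card T + card ?Q"
        using assms(3) by (intro card_Un_disjoint) auto
      also have "card ?Q = length P"
        using True assms(2) by (intro card_Int_pair_points) auto
      also have "card X = k"
        using assms(1) \<open>X \<in> B\<close> by (auto simp: uniform_blocks_def)
      finally have "(\<Sum>x\<in>- (T \<union> pair_points P). of_bool (insert x T \<subseteq> X))
          = real k - card T - length P"
        by simp
      then show ?thesis
        using True by (simp only: sum_distrib_left [symmetric]) simp
    qed auto
  qed
  finally show ?thesis
    by (simp only: pair_sum_def sum_distrib_left)
qed

text \<open>
  The next two lemmas differ in the type of the index: the natural number is needed for
  divisibility, the real number is what averaging arguments produce.
\<close>

lemma comb_design_iff_pair_sum:
  fixes B :: "'a::finite set set"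
  assumes "uniform_blocks k B"
  shows "comb_design t UNIV B \<longleftrightarrow> (\<exists>\<mu>::nat. \<forall>T. card T = t \<longrightarrow> pair_sum B [] T = \<mu>)"
  using assms by (auto simp: comb_design_def pair_sum_Nil uniform_blocks_def)

lemma comb_design_iff_real:
  fixes B :: "'a::finite set set"
  assumes "uniform_blocks k B"
  shows "comb_design t UNIV B \<longleftrightarrow> (\<exists>\<mu>. \<forall>T. card T = t \<longrightarrow> pair_sum B [] T = \<mu>)"
proof
  assume "\<exists>\<mu>. \<forall>T. card T = t \<longrightarrow> pair_sum B [] T = \<mu>"
  then obtain \<mu> where \<mu>: "\<And>T. card T = t \<Longrightarrow> pair_sum B [] T = \<mu>" by blast
  show "comb_design t UNIV B"
  proof (cases "\<exists>T::'a set. card T = t")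
    case True
    then obtain T0 :: "'a set" where "card T0 = t" by blast
    then have "\<mu> = real (card {X\<in>B. T0 \<subseteq> X})"
      using \<mu> [of T0] by (simp add: pair_sum_Nil)
    then show ?thesis
      using \<mu> by (auto simp: comb_design_iff_pair_sum [OF assms])
  qed (auto simp: comb_design_iff_pair_sum [OF assms])
qed (auto simp: comb_design_iff_pair_sum [OF assms])

lemma comb_design_0:
  fixes B :: "'a::finite set set"
  assumes "uniform_blocks k B"
  shows "comb_design 0 UNIV B"
  unfolding comb_design_iff_real [OF assms] by simp

text \<open>
  Expanding one pair gives the difference of two sums over the same remaining pairs, with
  one point more in \<open>T\<close>. With no pairs left, both are the index of the design.
\<close>

lemma comb_design_pair_sum_eq_0:
  fixes B :: "'a::finite set set"
  assumes "uniform_blocks k B" and "comb_design t UNIV B"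
    and "P \<noteq> []" and "disjoint_pairs P" and "T \<inter> pair_points P = {}"
    and "card T + length P = t"
  shows "pair_sum B P T = 0"
proof -
  obtain \<mu> where \<mu>: "\<And>T. card T = t \<Longrightarrow> pair_sum B [] T = \<mu>"
    using assms(2) unfolding comb_design_iff_real [OF assms(1)] by blast
  from assms(4-6) have "pair_sum B P T = (if P = [] then \<mu> else 0)"
  proof (induction P arbitrary: T)
    case Nil
    then show ?case using \<mu> by simp
  next
    case (Cons p P)
    obtain a b where p: "p = (a, b)" by force
    have "pair_sum B P (insert x T) = (if P = [] then \<mu> else 0)" if "x \<in> {a, b}" for x
      using Cons.prems that by (intro Cons.IH) (auto simp: p)
    then show ?case
      by (simp add: p pair_sum_Cons)
  qed
  with assms(3) show ?thesis by simp
qed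

text \<open>
  The converse: pairs are removed one at a time. The vanishing sum for \<open>(x, u) # P\<close> says
  that the sum for \<open>P\<close> does not change when the point \<open>u\<close> of \<open>T\<close> is replaced by \<open>x\<close>. It
  thus equals its average over all admissible \<open>x\<close>, and \<open>sum_pair_sum_insert\<close> reduces that
  average to strength \<open>t\<close>, where it is zero as long as a pair is left and the index once
  none is.
\<close>

lemma comb_design_SucI:
  fixes B :: "'a::finite set set"
  assumes B: "uniform_blocks k B" and design: "comb_design t UNIV B"
    and size: "2 * Suc t \<le> CARD('a)"
    and zero: "\<And>P. disjoint_pairs P \<Longrightarrow> length P = Suc t \<Longrightarrow> pair_sum B P {} = 0"
  shows "comb_design (Suc t) UNIV B"
proof -
  have all0: "pair_sum B P T = 0"
    if "j \<le> t" "disjoint_pairs P" "T \<inter> pair_points P = {}" "card T = j" "length P = Suc t - j"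
    for j P T
    using that
  proof (induction j arbitrary: P T)
    case 0
    then show ?case using zero by simp
  next
    case (Suc j)
    obtain u U where T: "T = insert u U" "u \<notin> U"
      using Suc.prems(4) by (auto simp: card_Suc_eq)
    then have U: "card U = j" "U \<inter> pair_points P = {}" "u \<notin> pair_points P"
      using Suc.prems by auto
    let ?R = "- (U \<union> pair_points P)"
    have const: "pair_sum B P (insert x U) = pair_sum B P T" if "x \<in> ?R" for x
    proof (cases "x = u")
      case False
      have "pair_sum B ((x, u) # P) U = 0"
        using False that T U Suc.prems by (intro Suc.IH) auto
      then show ?thesis by (simp add: pair_sum_Cons T)
    qed (simp add: T)
    have "real (card ?R) * pair_sum B P T = (\<Sum>x\<in>?R. pair_sum B P (insert x U))"
      by (simp add: const)
    also have "\<dots> = (real k - card U - length P) * pair_sum B P U"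
      using Suc.prems U by (intro sum_pair_sum_insert [OF B]) auto
    also have "pair_sum B P U = 0"
      using Suc.prems U by (intro comb_design_pair_sum_eq_0 [OF B design]) auto
    finally have "card ?R = 0 \<or> pair_sum B P T = 0" by simp
    moreover have "u \<in> ?R" using T U by auto
    ultimately show ?case by (metis card_eq_0_iff empty_iff finite)
  qed
  obtain \<mu> where \<mu>: "\<And>T. card T = t \<Longrightarrow> pair_sum B [] T = \<mu>"
    using design unfolding comb_design_iff_real [OF B] by blast
  have "pair_sum B [] T = (real k - t) * \<mu> / (real CARD('a) - t)" if card_T: "card T = Suc t" for T
  proof -
    obtain u U where T: "T = insert u U" "u \<notin> U" "card U = t"
      using card_T by (auto simp: card_Suc_eq)
    have const: "pair_sum B [] (insert x U) = pair_sum B [] T" if "x \<in> - U" for x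
    proof (cases "x = u")
      case False
      have "pair_sum B [(x, u)] U = 0"
        using False that T by (intro all0 [of t "[(x, u)]" U]) auto
      then show ?thesis by (simp add: pair_sum_Cons T)
    qed (simp add: T)
    have "real (card (- U)) * pair_sum B [] T = (\<Sum>x\<in>- U. pair_sum B [] (insert x U))"
      by (simp add: const)
    also have "\<dots> = (real k - t) * \<mu>"
      using sum_pair_sum_insert [OF B, of "[]" U] T \<mu> by simp
    also have "real (card (- U)) = real CARD('a) - t"
      using T(3) by (simp add: real_card_Compl)
    finally show ?thesis
      using size by (simp add: field_simps)
  qed
  then show ?thesis
    unfolding comb_design_iff_real [OF B] by blast
qed

lemma comb_design_down:
  fixes B :: "'a::finite set set"
  assumes B: "uniform_blocks k B" and design: "comb_design t UNIV B" and "s \<le> t" and "t \<le> k"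
  shows "comb_design s UNIV B"
  using \<open>s \<le> t\<close> 
proof (induction rule: inc_induct)
  case (step s)
  obtain \<mu> where \<mu>: "\<And>T. card T = Suc s \<Longrightarrow> pair_sum B [] T = \<mu>"
    using step.IH unfolding comb_design_iff_real [OF B] by blast
  have "pair_sum B [] U = (real CARD('a) - s) * \<mu> / (real k - s)" if "card U = s" for U
  proof -
    have "(\<Sum>x\<in>- U. pair_sum B [] (insert x U)) = (real k - s) * pair_sum B [] U"
      using sum_pair_sum_insert [OF B, of "[]" U] that by simp
    moreover have "(\<Sum>x\<in>- U. pair_sum B [] (insert x U)) = (\<Sum>x\<in>- U. \<mu>)"
      using that by (intro sum.cong) (auto intro!: \<mu>)
    moreover have "real (card (- U)) = real CARD('a) - s"
      using that by (simp add: real_card_Compl)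
    ultimately show ?thesis
      using step.hyps \<open>t \<le> k\<close> by (simp add: field_simps)
  qed
  then show ?case
    unfolding comb_design_iff_real [OF B] by blast
qed (rule design)

text \<open>
  Double counting of the pairs of a block and a new point in it relates the indices of
  consecutive strengths; the index of strength \<open>0\<close> is the number of blocks.
\<close>

lemma comb_design_count:
  fixes B :: "'a::finite set set"
  assumes B: "uniform_blocks k B" and "comb_design t UNIV B" and "t \<le> k" and "t \<le> CARD('a)"
  shows "(\<Prod>i<t. CARD('a) - i) dvd card B * (\<Prod>i<t. k - i)"
proof -
  have "\<exists>\<mu>::nat. (\<forall>T. card T = t \<longrightarrow> pair_sum B [] T = real \<mu>) \<and>
          \<mu> * (\<Prod>i<t. CARD('a) - i) = card B * (\<Prod>i<t. k - i)"
    using assms(2-4)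
  proof (induction t)
    case 0
    then show ?case by (auto simp: pair_sum_Nil)
  next
    case (Suc t)
    have "comb_design t UNIV B"
      using comb_design_down [OF B Suc.prems(1)] Suc.prems(2) by simp
    then obtain \<mu> :: nat where \<mu>: "\<And>T. card T = t \<Longrightarrow> pair_sum B [] T = real \<mu>"
      and eq: "\<mu> * (\<Prod>i<t. CARD('a) - i) = card B * (\<Prod>i<t. k - i)"
      using Suc by auto
    obtain \<nu> :: nat where \<nu>: "\<And>T. card T = Suc t \<Longrightarrow> pair_sum B [] T = \<nu>"
      using Suc.prems(1) unfolding comb_design_iff_pair_sum [OF B] by blast
    obtain U :: "'a set" where U: "card U = t"
      using Suc.prems(3) by (metis Suc_leD obtain_subset_with_card_n)
    have "(\<Sum>x\<in>- U. pair_sum B [] (insert x U)) = (real k - t) * \<mu>"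
      using sum_pair_sum_insert [OF B, of "[]" U] U \<mu> by simp
    moreover have "(\<Sum>x\<in>- U. pair_sum B [] (insert x U)) = (\<Sum>x\<in>- U. real \<nu>)"
      using U by (intro sum.cong) (auto intro!: \<nu>)
    moreover have "card (- U) = CARD('a) - t"
      using U by (simp add: Compl_eq_Diff_UNIV card_Diff_subset)
    ultimately have "real ((CARD('a) - t) * \<nu>) = real ((k - t) * \<mu>)"
      using Suc.prems by (simp add: of_nat_diff)
    then have "\<nu> * (CARD('a) - t) = \<mu> * (k - t)"
      by (simp only: of_nat_eq_iff mult.commute)
    then have "\<nu> * (\<Prod>i<Suc t. CARD('a) - i) = card B * (\<Prod>i<Suc t. k - i)"
      using eq by (simp add: mult.assoc [symmetric]) (metis mult.assoc mult.commute)
    then show ?case using \<nu> by blast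
  qed
  then show ?thesis by (metis dvd_triv_right)
qed

text \<open>
  The Bezout relation turns \<open>D dvd a * N\<close> into \<open>D dvd a * h\<close>. With \<open>h\<close> the greatest common
  divisor of \<open>D\<close> and \<open>N\<close>, nothing is lost, and no such divisor has to be evaluated.
\<close>

lemma dvd_of_bezout:
  fixes a :: nat
  assumes "D dvd a * N" and "u * N = h + v * D" and "D = m * h" and "0 < h"
  shows "m dvd a"
proof -
  have "D dvd u * (a * N)"
    using assms(1) by simp
  also have "u * (a * N) = a * (u * N)"
    by (simp add: mult_ac)
  also have "\<dots> = a * h + a * v * D"
    unfolding assms(2) by (simp add: algebra_simps)
  finally have "m * h dvd a * h"
    by (simp add: assms(3) dvd_add_left_iff)
  with assms(4) show ?thesis by simp
qed

section \<open>The twisted MacWilliams identity\<close>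

definition bit_sign :: "bit \<Rightarrow> real" where
  "bit_sign b = (if b = 0 then 1 else -1)"

lemma bit_sign_simps [simp]: "bit_sign 0 = 1" "bit_sign 1 = -1"
  by (auto simp: bit_sign_def)

lemma bit_sign_add: "bit_sign (a + b) = bit_sign a * bit_sign b"
  by (cases a; cases b) auto

lemma bit_sign_sum: "finite A \<Longrightarrow> bit_sign (sum f A) = (\<Prod>i\<in>A. bit_sign (f i))"
  by (induction rule: finite_induct) (simp_all add: bit_sign_add del: add_bit_eq_xor)

lemma UNIV_bit: "(UNIV :: bit set) = {0, 1}"
  using bit.exhaust by blast

instance bit :: finite
  by standard (simp add: UNIV_bit)

lemma sum_over_bit: "(\<Sum>b\<in>UNIV. h b) = h 0 + h (1 :: bit)" for h :: "bit \<Rightarrow> real"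
  unfolding UNIV_bit by simp

lemma bilin_add_right: "bilin x (y + z) = bilin x y + bilin x z"
  by (simp only: bilin_def vector_add_component distrib_left sum.distrib)

lemma bit_sign_bilin: "bit_sign (bilin x y) = (\<Prod>i\<in>UNIV. bit_sign (x $ i * y $ i))"
  by (simp only: bilin_def bit_sign_sum [OF finite])

text \<open>
  Translation by a word of \<open>C\<close> that is not orthogonal to \<open>x\<close> changes every sign.
\<close>

lemma character_sum:
  assumes "vec.subspace C"
  shows "(\<Sum>c\<in>C. bit_sign (bilin x c)) = (if x \<in> dual_code C then real (card C) else 0)"
proof (cases "x \<in> dual_code C")
  case True
  then show ?thesis by (simp add: dual_code_def)
next
  case False
  then obtain c0 where c0: "c0 \<in> C" "bilin x c0 = 1"
    by (auto simp: dual_code_def)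
  have "(\<Sum>c\<in>C. bit_sign (bilin x c)) = (\<Sum>c\<in>C. bit_sign (bilin x (c0 + c)))"
    by (rule sum.reindex_bij_witness [of _ "\<lambda>c. c0 + c" "\<lambda>c. c - c0"])
       (use c0 assms in \<open>auto intro: vec.subspace_add vec.subspace_diff\<close>)
  also have "\<dots> = (\<Sum>c\<in>C. - bit_sign (bilin x c))"
    by (intro sum.cong refl, subst bilin_add_right, subst bit_sign_add) (simp add: c0)
  finally show ?thesis
    using False by (simp add: sum_negf)
qed

text \<open>
  The Fourier transform of a product function over the binary space is the product of the
  transforms in each coordinate.
\<close>

lemma product_fourier_transform:
  fixes f :: "'n::finite \<Rightarrow> bit \<Rightarrow> real"
  shows "(\<Prod>i\<in>UNIV. f i 0 + bit_sign (c $ i) * f i 1)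
           = (\<Sum>x\<in>UNIV. bit_sign (bilin x c) * (\<Prod>i\<in>UNIV. f i (x $ i)))"
proof -
  have "(\<Prod>i\<in>UNIV. f i 0 + bit_sign (c $ i) * f i 1)
      = (\<Prod>i\<in>UNIV. \<Sum>b\<in>UNIV. bit_sign (b * c $ i) * f i b)"
    by (intro prod.cong) (simp_all add: sum_over_bit bit_sign_def)
  also have "\<dots> = (\<Sum>g\<in>UNIV. \<Prod>i\<in>UNIV. bit_sign (g i * c $ i) * f i (g i))"
    by (subst prod_sum_PiE) auto
  also have "\<dots> = (\<Sum>x\<in>UNIV. \<Prod>i\<in>UNIV. bit_sign (x $ i * c $ i) * f i (x $ i))"
    by (rule sum.reindex_bij_witness [of _ vec_nth vec_lambda]) (auto simp: vec_lambda_inverse)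
  finally show ?thesis
    by (simp only: prod.distrib bit_sign_bilin)
qed

lemma poisson_summation:
  fixes C :: "(bit ^ 'n::finite) set" and f :: "'n \<Rightarrow> bit \<Rightarrow> real"
  assumes "self_dual C"
  shows "(\<Sum>c\<in>C. \<Prod>i\<in>UNIV. f i 0 + bit_sign (c $ i) * f i 1)
           = card C * (\<Sum>c\<in>C. \<Prod>i\<in>UNIV. f i (c $ i))"
proof -
  have C: "vec.subspace C" "dual_code C = C"
    using assms by (auto simp: self_dual_def)
  have "(\<Sum>c\<in>C. \<Prod>i\<in>UNIV. f i 0 + bit_sign (c $ i) * f i 1)
      = (\<Sum>x\<in>UNIV. (\<Sum>c\<in>C. bit_sign (bilin x c)) * (\<Prod>i\<in>UNIV. f i (x $ i)))"
    unfolding product_fourier_transform sum_distrib_right by (rule sum.swap)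
  also have "\<dots> = (\<Sum>x\<in>UNIV. if x \<in> C then card C * (\<Prod>i\<in>UNIV. f i (x $ i)) else 0)"
    by (intro sum.cong) (auto simp: character_sum C)
  also have "\<dots> = (\<Sum>x\<in>C. card C * (\<Prod>i\<in>UNIV. f i (x $ i)))"
    by (simp add: sum.If_cases)
  finally show ?thesis
    by (simp add: sum_distrib_left)
qed

text \<open>
  Poisson summation for the constant function \<open>1\<close>, whose transform is supported at \<open>0\<close>.
\<close>

lemma card_self_dual:
  fixes C :: "(bit ^ 'n::finite) set"
  assumes "self_dual C"
  shows "card C ^ 2 = 2 ^ CARD('n)"
proof -
  have "0 \<in> C"
    using assms by (auto simp: self_dual_def vec.subspace_0)
  have "(\<Sum>c\<in>C. \<Prod>i\<in>UNIV. 1 + bit_sign (c $ i)) = (\<Sum>c\<in>C. if c = 0 then 2 ^ CARD('n) else 0)"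
  proof (intro sum.cong refl)
    fix c :: "bit ^ 'n"
    show "(\<Prod>i\<in>UNIV. 1 + bit_sign (c $ i)) = (if c = 0 then 2 ^ CARD('n) else 0)"
    proof (cases "c = 0")
      case False
      then obtain i where "c $ i = 1"
        by (auto simp: vec_eq_iff)
      then have "1 + bit_sign (c $ i) = 0"
        by simp
      then have "(\<Prod>i\<in>UNIV. 1 + bit_sign (c $ i)) = 0"
        by (meson UNIV_I finite prod_zero)
      then show ?thesis using False by simp
    qed simp
  qed
  also have "\<dots> = 2 ^ CARD('n)"
    using \<open>0 \<in> C\<close> by (simp add: sum.delta)
  finally have "real (card C * card C) = real (2 ^ CARD('n))"
    using poisson_summation [OF assms, of "\<lambda>_ _. 1"] by simp
  then show ?thesis
    by (simp only: of_nat_eq_iff power2_eq_square)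
qed

text \<open>
  The factor of a pair \<open>(a, b)\<close> is a difference of two product functions of the
  coordinates: \<open>[s = 1] * 1 - 1 * [t = 1]\<close>. Its transform is \<open>-2\<close> times itself, since the
  transforms of \<open>[s = 1]\<close> and \<open>1\<close> are \<open>(-1)^s\<close> and \<open>1 + (-1)^s\<close>. So pairs are split off
  one by one, for arbitrary functions at all other coordinates.
\<close>

lemma poisson_summation_pairs:
  fixes C :: "(bit ^ 'n::finite) set" and f :: "'n \<Rightarrow> bit \<Rightarrow> real"
  assumes "self_dual C" and "disjoint_pairs P"
  shows "(-2) ^ length P * (\<Sum>c\<in>C. pair_sign P (supp c) *
             (\<Prod>i\<in>- pair_points P. f i 0 + bit_sign (c $ i) * f i 1))
           = card C * (\<Sum>c\<in>C. pair_sign P (supp c) * (\<Prod>i\<in>- pair_points P. f i (c $ i)))"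
  using assms(2)
proof (induction P arbitrary: f)
  case Nil
  show ?case using poisson_summation [OF assms(1), of f] by simp
next
  case (Cons p P)
  obtain a b where p: "p = (a, b)" by force
  let ?R = "- pair_points (p # P)"
  have ab: "a \<noteq> b" "a \<notin> pair_points P" "b \<notin> pair_points P" "disjoint_pairs P"
    using Cons.prems by (auto simp: p)
  have split: "(\<Prod>i\<in>- pair_points P. h i) = h a * h b * (\<Prod>i\<in>?R. h i)" for h :: "'n \<Rightarrow> real"
  proof -
    have "- pair_points P = insert a (insert b ?R)"
      using ab by (auto simp: p)
    moreover have "a \<notin> insert b ?R" "b \<notin> ?R"
      using ab by (auto simp: p)
    ultimately show ?thesis by simp
  qed
  have R: "i \<noteq> a" "i \<noteq> b" if "i \<in> ?R" for i
    using that by (auto simp: p)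
  \<comment> \<open>The two product functions whose difference is the factor of the pair \<open>(a, b)\<close>.\<close>
  define f1 where "f1 = f(a := \<lambda>s. of_bool (s = 1), b := \<lambda>_. 1)"
  define f2 where "f2 = f(a := \<lambda>_. 1, b := \<lambda>s. of_bool (s = 1))"
  have on_R: "(\<Prod>i\<in>?R. f' i 0 + bit_sign (c $ i) * f' i 1) = (\<Prod>i\<in>?R. f i 0 + bit_sign (c $ i) * f i 1)"
    "(\<Prod>i\<in>?R. f' i (c $ i)) = (\<Prod>i\<in>?R. f i (c $ i))" if "f' \<in> {f1, f2}" for f' c
    using that R by (auto simp: f1_def f2_def intro!: prod.cong)
  have supp: "of_bool (i \<in> supp c) = (of_bool (c $ i = 1) :: real)" for i and c :: "bit ^ 'n"
    by (simp add: supp_def)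
  have hat: "pair_sign P (supp c) * (\<Prod>i\<in>- pair_points P. f1 i 0 + bit_sign (c $ i) * f1 i 1)
        - pair_sign P (supp c) * (\<Prod>i\<in>- pair_points P. f2 i 0 + bit_sign (c $ i) * f2 i 1)
      = -2 * (pair_sign (p # P) (supp c) * (\<Prod>i\<in>?R. f i 0 + bit_sign (c $ i) * f i 1))" for c
  proof -
    have 1: "(\<Prod>i\<in>- pair_points P. f1 i 0 + bit_sign (c $ i) * f1 i 1)
        = bit_sign (c $ a) * (1 + bit_sign (c $ b)) * (\<Prod>i\<in>?R. f i 0 + bit_sign (c $ i) * f i 1)"
      unfolding split using on_R(1) [of f1] ab by (simp add: f1_def)
    have 2: "(\<Prod>i\<in>- pair_points P. f2 i 0 + bit_sign (c $ i) * f2 i 1)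
        = (1 + bit_sign (c $ a)) * bit_sign (c $ b) * (\<Prod>i\<in>?R. f i 0 + bit_sign (c $ i) * f i 1)"
      unfolding split using on_R(1) [of f2] ab by (simp add: f2_def)
    have 3: "bit_sign (c $ i) = 1 - 2 * of_bool (i \<in> supp c)" for i
      by (cases "c $ i") (simp_all add: supp)
    have 4: "s * ((1 - 2 * u) * (1 + (1 - 2 * v)) * r) - s * ((1 + (1 - 2 * u)) * (1 - 2 * v) * r)
        = -2 * ((u - v) * s * r)" for s u v r :: real
      by (simp add: algebra_simps)
    show ?thesis
      unfolding 1 2 3 [of a] 3 [of b] 4 p pair_sign_Cons ..
  qed
  have id: "pair_sign P (supp c) * (\<Prod>i\<in>- pair_points P. f1 i (c $ i))
        - pair_sign P (supp c) * (\<Prod>i\<in>- pair_points P. f2 i (c $ i))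
      = pair_sign (p # P) (supp c) * (\<Prod>i\<in>?R. f i (c $ i))" for c
  proof -
    have "(\<Prod>i\<in>- pair_points P. f1 i (c $ i)) = of_bool (a \<in> supp c) * (\<Prod>i\<in>?R. f i (c $ i))"
      unfolding split using on_R(2) [of f1] ab by (simp add: f1_def supp)
    moreover have "(\<Prod>i\<in>- pair_points P. f2 i (c $ i)) = of_bool (b \<in> supp c) * (\<Prod>i\<in>?R. f i (c $ i))"
      unfolding split using on_R(2) [of f2] ab by (simp add: f2_def supp)
    ultimately show ?thesis
      by (simp add: p algebra_simps)
  qed
  have "(-2) ^ length P *
          ((\<Sum>c\<in>C. pair_sign P (supp c) * (\<Prod>i\<in>- pair_points P. f1 i 0 + bit_sign (c $ i) * f1 i 1))
         - (\<Sum>c\<in>C. pair_sign P (supp c) * (\<Prod>i\<in>- pair_points P. f2 i 0 + bit_sign (c $ i) * f2 i 1)))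
      = card C *
          ((\<Sum>c\<in>C. pair_sign P (supp c) * (\<Prod>i\<in>- pair_points P. f1 i (c $ i)))
         - (\<Sum>c\<in>C. pair_sign P (supp c) * (\<Prod>i\<in>- pair_points P. f2 i (c $ i))))"
    by (simp only: right_diff_distrib Cons.IH [OF ab(4)])
  then have "(-2) ^ length P * (-2 * (\<Sum>c\<in>C. pair_sign (p # P) (supp c) *
               (\<Prod>i\<in>?R. f i 0 + bit_sign (c $ i) * f i 1)))
      = card C * (\<Sum>c\<in>C. pair_sign (p # P) (supp c) * (\<Prod>i\<in>?R. f i (c $ i)))"
    by (simp only: sum_subtractf [symmetric] hat id sum_distrib_left [symmetric])
  then show ?case
    by (simp only: length_Cons power_Suc mult_ac)
qed

text \<open>
  The previous lemma for the function \<open>y^s\<close> on each coordinate outside the pairs. A word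
  with nonzero sign has exactly \<open>d\<close> ones on the pairs, whence the exponents.
\<close>

lemma macwilliams_pairs:
  fixes C :: "(bit ^ 'n::finite) set"
  assumes "self_dual C" and P: "disjoint_pairs P" "length P = d"
  shows "(-2) ^ d * (\<Sum>c\<in>C. pair_sign P (supp c) *
             ((1 - y) ^ (wt c - d) * (1 + y) ^ (CARD('n) - d - wt c)))
           = card C * (\<Sum>c\<in>C. pair_sign P (supp c) * y ^ (wt c - d))"
proof -
  have ones: "card {i\<in>- pair_points P. c $ i = 1} = wt c - d" 
    and zeros: "card {i\<in>- pair_points P. c $ i = 0} = CARD('n) - d - wt c"
    if "pair_sign P (supp c) \<noteq> 0" for c
  proof -
    have d: "card (supp c \<inter> pair_points P) = d"
      using card_Int_pair_points that P by blast
    have eq: "{i\<in>- pair_points P. c $ i = 1} = supp c - supp c \<inter> pair_points P"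
      by (auto simp: supp_def)
    show ones: "card {i\<in>- pair_points P. c $ i = 1} = wt c - d"
      unfolding eq by (subst card_Diff_subset) (auto simp: d wt_def)
    have "d \<le> wt c"
      unfolding wt_def d [symmetric] by (intro card_mono) auto
    have "card {i\<in>- pair_points P. c $ i = 0} + card {i\<in>- pair_points P. c $ i = 1}
        = card ({i\<in>- pair_points P. c $ i = 0} \<union> {i\<in>- pair_points P. c $ i = 1})"
      by (intro card_Un_disjoint [symmetric]) auto
    also have "{i\<in>- pair_points P. c $ i = 0} \<union> {i\<in>- pair_points P. c $ i = 1} = - pair_points P"
      by auto
    also have "card (- pair_points P) = CARD('n) - 2 * d"
      using card_pair_points [OF P(1)] P(2) by (simp add: Compl_eq_Diff_UNIV card_Diff_subset)
    finally show "card {i\<in>- pair_points P. c $ i = 0} = CARD('n) - d - wt c"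
      using ones \<open>d \<le> wt c\<close> by simp
  qed
  have prod: "(\<Prod>i\<in>- pair_points P. if c $ i = 0 then u else v)
      = u ^ card {i\<in>- pair_points P. c $ i = 0} * v ^ card {i\<in>- pair_points P. c $ i = 1}"
    for c :: "bit ^ 'n" and u v :: real
    by (simp add: prod.If_cases Int_def)
  define f where "f = (\<lambda>(i::'n) (s::bit). if s = 0 then 1 else y)"
  have "pair_sign P (supp c) * (\<Prod>i\<in>- pair_points P. f i 0 + bit_sign (c $ i) * f i 1)
      = pair_sign P (supp c) * ((1 - y) ^ (wt c - d) * (1 + y) ^ (CARD('n) - d - wt c))" for c
  proof (cases "pair_sign P (supp c) = 0")
    case False
    have "f i 0 + bit_sign (c $ i) * f i 1 = (if c $ i = 0 then 1 + y else 1 - y)" for i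
      by (simp add: f_def bit_sign_def)
    then show ?thesis
      by (simp only: prod ones [OF False] zeros [OF False] mult.commute)
  qed simp
  moreover have "pair_sign P (supp c) * (\<Prod>i\<in>- pair_points P. f i (c $ i))
      = pair_sign P (supp c) * y ^ (wt c - d)" for c
  proof (cases "pair_sign P (supp c) = 0")
    case False
    then show ?thesis
      unfolding f_def by (simp only: prod ones [OF False]) simp
  qed simp
  ultimately show ?thesis
    using poisson_summation_pairs [OF assms(1,2), of f] P(2) by (simp only:)
qed

section \<open>Invariant polynomials\<close>

text \<open>
  Apart from the scalar, the condition says that \<open>y^m * g(y^4)\<close>, seen as a binary form of
  degree \<open>2 * m + 4 * (m + d)\<close>, is fixed by the substitution of \<open>(1 - y) / (1 + y)\<close> for
  \<open>y\<close>. The sum is the homogenized \<open>g\<close>, which avoids a denominator at \<open>y = -1\<close>.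
\<close>

definition invariant_poly :: "nat \<Rightarrow> nat \<Rightarrow> real poly \<Rightarrow> bool" where
  "invariant_poly m d g \<longleftrightarrow> degree g \<le> m + d \<and>
     (\<forall>y. (1 - y\<^sup>2) ^ m * (\<Sum>j\<le>m + d. coeff g j * (1 - y) ^ (4 * j) * (1 + y) ^ (4 * (m + d - j)))
        = 8 ^ m * (-4) ^ d * y ^ m * poly g (y ^ 4))"

lemma invariant_polyD:
  assumes "invariant_poly m d g"
  shows "(1 - y\<^sup>2) ^ m * (\<Sum>j\<le>m + d. coeff g j * (1 - y) ^ (4 * j) * (1 + y) ^ (4 * (m + d - j)))
    = 8 ^ m * (-4) ^ d * y ^ m * poly g (y ^ 4)"
  using assms by (auto simp: invariant_poly_def)

lemma poly_eq_sum_atMost: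
  fixes p :: "'a::comm_ring_1 poly"
  assumes "degree p \<le> n"
  shows "poly p x = (\<Sum>i\<le>n. coeff p i * x ^ i)"
  unfolding poly_altdef using assms
  by (intro sum.mono_neutral_left) (auto simp: coeff_eq_0)

lemma homogeneous_eval:
  fixes y :: real
  assumes "degree p \<le> n" and "1 + y \<noteq> 0"
  shows "(\<Sum>j\<le>n. coeff p j * (1 - y) ^ (4 * j) * (1 + y) ^ (4 * (n - j)))
    = (1 + y) ^ (4 * n) * poly p (((1 - y) / (1 + y)) ^ 4)"
  unfolding poly_eq_sum_atMost [OF assms(1)] sum_distrib_left
proof (intro sum.cong refl)
  fix j assume "j \<in> {..n}"
  then have "4 * n = 4 * j + 4 * (n - j)"
    by simp
  then have "(1 + y) ^ (4 * n) = (1 + y) ^ (4 * j) * (1 + y) ^ (4 * (n - j))"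
    by (metis power_add)
  then show "coeff p j * (1 - y) ^ (4 * j) * (1 + y) ^ (4 * (n - j))
      = (1 + y) ^ (4 * n) * (coeff p j * (((1 - y) / (1 + y)) ^ 4) ^ j)"
    using assms(2) by (simp add: power_divide power_mult)
qed

text \<open>
  The map \<open>x \<mapsto> x^4\<close> is unramified at \<open>1\<close>: the cofactor \<open>1 + x + x^2 + x^3\<close> of \<open>x - 1\<close> in
  \<open>x^4 - 1\<close> does not vanish there.
\<close>

lemma order_pcompose_fourth_power:
  fixes g :: "real poly"
  assumes "g \<noteq> 0"
  shows "order 1 (pcompose g (monom 1 4)) = order 1 g"
proof -
  define k where "k = order 1 g"
  obtain h where h: "g = [:-1, 1:] ^ k * h" "\<not> [:-1, 1:] dvd h"
    using order_decomp [OF assms, of 1] by (auto simp: k_def)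
  define r where "r = [:1, 1, 1, 1:] ^ k * pcompose h (monom 1 4)"
  have "pcompose g (monom 1 4) = [:-1, 1:] ^ k * r"
  proof (rule poly_ext)
    fix x :: real
    have "x ^ 4 - 1 = (x - 1) * (1 + x * (1 + x * (1 + x)))"
      by (simp add: algebra_simps power_numeral_reduce)
    then show "poly (pcompose g (monom 1 4)) x = poly ([:-1, 1:] ^ k * r) x"
      by (simp add: r_def h(1) poly_pcompose poly_monom power_mult_distrib)
  qed
  moreover have "poly r 1 \<noteq> 0"
    using h(2) by (simp add: r_def poly_pcompose poly_monom poly_eq_0_iff_dvd)
  moreover from this have "r \<noteq> 0" by auto
  ultimately have "order 1 (pcompose g (monom 1 4)) = k + 0"
    using order_power_n_n [of "1 :: real" k] by (simp add: order_mult order_0I)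
  then show ?thesis by (simp add: k_def)
qed

text \<open>
  The left side of the invariance has a zero of order \<open>m\<close> at \<open>y = 1\<close>, and \<open>y^m\<close> has none
  there.
\<close>

lemma invariant_poly_dvd:
  assumes "invariant_poly m d g"
  shows "[:-1, 1:] ^ m dvd g"
proof (cases "g = 0")
  case False
  define R where "R = (\<Sum>j\<le>m + d. smult (coeff g j) ([:1, -1:] ^ (4 * j) * [:1, 1:] ^ (4 * (m + d - j))))"
  define p where "p = pcompose g (monom 1 4)"
  have "[:-1, 1:] ^ m * ([:-1, -1:] ^ m * R) = smult (8 ^ m * (-4) ^ d) (monom 1 m * p)"
  proof (rule poly_ext)
    fix y :: real
    have "1 - y\<^sup>2 = (y - 1) * (- 1 - y)"
      by (simp add: algebra_simps power2_eq_square)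
    then have "(1 - y\<^sup>2) ^ m = (y - 1) ^ m * (- 1 - y) ^ m"
      by (simp only: power_mult_distrib)
    then show "poly ([:-1, 1:] ^ m * ([:-1, -1:] ^ m * R)) y
        = poly (smult (8 ^ m * (-4) ^ d) (monom 1 m * p)) y"
      using invariant_polyD [OF assms, of y]
      by (simp add: R_def p_def poly_sum poly_monom poly_pcompose power_mult_distrib mult.assoc)
  qed
  then have "[:-1, 1:] ^ m dvd smult (8 ^ m * (-4) ^ d) (monom 1 m * p)"
    by (metis dvd_triv_left)
  then have "[:-1, 1:] ^ m dvd monom 1 m * p"
    by (simp add: dvd_smult_iff)
  moreover have "p \<noteq> 0"
    unfolding p_def using False by (simp add: pcompose_eq_0_iff degree_monom_eq)
  ultimately have "m \<le> order 1 (monom 1 m * p)"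
    using order_divides [of "1 :: real" m] by simp
  also have "\<dots> = order 1 g"
    using \<open>p \<noteq> 0\<close> order_pcompose_fourth_power [OF False]
    by (simp add: order_mult order_0I poly_monom p_def)
  finally show ?thesis
    using order_divides [of "1 :: real" m] by simp
qed simp

text \<open>
  The invariance of the quotient of \<open>g\<close> by \<open>(u - 1)^m\<close>; the powers of the factor
  \<open>y * (1 - y^4)\<close> have been cancelled, which is why its real zeros are left out.
\<close>

definition reduced_invariant :: "nat \<Rightarrow> real poly \<Rightarrow> bool" where
  "reduced_invariant d q \<longleftrightarrow> degree q \<le> d \<and> (\<forall>y. y \<notin> {0, 1, -1} \<longrightarrow>
     (\<Sum>i\<le>d. coeff q i * ((1 - y) ^ (4 * i) * (1 + y) ^ (4 * (d - i)) - (-4) ^ d * y ^ (4 * i))) = 0)"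

lemma reduced_invariantD:
  assumes "reduced_invariant d q"
  shows "degree q \<le> d"
    and "y \<notin> {0, 1, -1} \<Longrightarrow>
      (\<Sum>i\<le>d. coeff q i * ((1 - y) ^ (4 * i) * (1 + y) ^ (4 * (d - i)) - (-4) ^ d * y ^ (4 * i))) = 0"
  using assms by (auto simp: reduced_invariant_def)

text \<open>
  The form \<open>y * (1 - y^4)\<close> is itself an invariant: the substitution turns it into
  \<open>8 * y * (1 - y^4) / (1 + y)^6\<close>. Hence its \<open>m\<close>-th power can be cancelled.
\<close>

lemma invariant_poly_quotient:
  assumes "invariant_poly m d g"
  obtains q where "g = [:-1, 1:] ^ m * q" and "reduced_invariant d q"
proof -
  obtain q where q: "g = [:-1, 1:] ^ m * q"
    using invariant_poly_dvd [OF assms] by (elim dvdE)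
  have deg_g: "degree g \<le> m + d"
    using assms by (simp add: invariant_poly_def)
  have deg: "degree q \<le> d"
  proof (cases "q = 0")
    case False
    then have "degree g = m + degree q"
      by (simp add: q degree_mult_eq degree_power_eq)
    with deg_g show ?thesis by simp
  qed simp
  have "(\<Sum>i\<le>d. coeff q i * ((1 - y) ^ (4 * i) * (1 + y) ^ (4 * (d - i)) - (-4) ^ d * y ^ (4 * i))) = 0"
    if y: "y \<notin> {0, 1, -1}" for y :: real
  proof -
    have nz: "1 + y \<noteq> 0" "1 - y \<noteq> 0" "y \<noteq> 0" "1 + y\<^sup>2 \<noteq> 0"
      using y by (auto simp: add_eq_0_iff power2_eq_square) (smt (verit) not_sum_squares_lt_zero)
    define x where "x = ((1 - y) / (1 + y)) ^ 4"
    note homog = homogeneous_eval [OF _ nz(1), folded x_def]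
    have "(1 + y) ^ 4 * (x - 1) = (1 - y) ^ 4 - (1 + y) ^ 4"
      using nz by (simp add: x_def power_divide field_simps)
    also have "\<dots> = - 8 * y * (1 + y\<^sup>2)"
      by (simp add: algebra_simps power_numeral_reduce)
    finally have x1: "(1 + y) ^ 4 * (x - 1) = - 8 * y * (1 + y\<^sup>2)" .
    have "8 ^ m * (-4) ^ d * y ^ m * poly g (y ^ 4) = (1 - y\<^sup>2) ^ m * ((1 + y) ^ (4 * (m + d)) * poly g x)"
      using invariant_polyD [OF assms, of y] by (simp only: homog [OF deg_g])
    also have "\<dots> = (1 - y\<^sup>2) ^ m * ((1 + y) ^ 4 * (x - 1)) ^ m * ((1 + y) ^ (4 * d) * poly q x)"
      by (simp add: q power_mult_distrib power_add power_mult distrib_left)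
    also have "\<dots> = (8 ^ m * y ^ m * (y ^ 4 - 1) ^ m) * ((1 + y) ^ (4 * d) * poly q x)"
    proof -
      have "(1 - y\<^sup>2) * (- 8 * y * (1 + y\<^sup>2)) = 8 * y * (y ^ 4 - 1)"
        by (simp add: algebra_simps power_numeral_reduce)
      then show ?thesis
        by (simp only: x1 power_mult_distrib [symmetric])
    qed
    finally have "(8 ^ m * y ^ m * (y ^ 4 - 1) ^ m) * ((1 + y) ^ (4 * d) * poly q x)
        = (8 ^ m * y ^ m * (y ^ 4 - 1) ^ m) * ((-4) ^ d * poly q (y ^ 4))"
      by (auto simp: q mult_ac)
    moreover have "y ^ 4 - 1 \<noteq> 0"
    proof -
      have "y ^ 4 - 1 = - ((1 - y) * (1 + y) * (1 + y\<^sup>2))"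
        by (simp add: algebra_simps power_numeral_reduce)
      then show ?thesis using nz by simp
    qed
    ultimately have "(1 + y) ^ (4 * d) * poly q x = (-4) ^ d * poly q (y ^ 4)"
      using nz by simp
    then have "(\<Sum>j\<le>d. coeff q j * (1 - y) ^ (4 * j) * (1 + y) ^ (4 * (d - j)))
        = (-4) ^ d * (\<Sum>j\<le>d. coeff q j * y ^ (4 * j))"
      unfolding homog [OF deg] poly_eq_sum_atMost [OF deg, of "y ^ 4"] by (simp only: power_mult)
    then show ?thesis
      by (simp add: right_diff_distrib sum_subtractf sum_distrib_left mult_ac)
  qed
  with q deg show thesis
    by (intro that) (auto simp: reduced_invariant_def)
qed

text \<open>
  For \<open>1 \<le> d \<le> 5\<close>, the solution of the reduced invariance with constant term \<open>1\<close>, or \<open>0\<close>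
  if there is none. For \<open>d = 2\<close> this is Gleason's invariant \<open>1 + 14 u + u^2\<close>, for \<open>d = 3\<close>
  it is \<open>(1 + u) (1 - 34 u + u^2)\<close>, and for \<open>d = 4\<close> and \<open>d = 5\<close> the first of these times
  itself and times the second.
\<close>

definition signed_factor :: "nat \<Rightarrow> real poly" where
  "signed_factor d =
     (if d = 2 then [:1, 14, 1:] else if d = 3 then [:1, -33, -33, 1:]
      else if d = 4 then [:1, 28, 198, 28, 1:] else if d = 5 then [:1, -19, -494, -494, -19, 1:]
      else 0)"

text \<open>
  For \<open>2 \<le> d \<le> 5\<close>, the weights at which the signed sums over \<open>d\<close> pairs vanish for every
  code. At \<open>48\<close> this is forced by antisymmetry when \<open>d\<close> is odd, as complementation changes
  the sign \<open>d\<close> times; at \<open>20\<close> and \<open>76\<close> it is the coincidence \<open>14 - 14 = 0\<close> in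
  \<open>(1 - u)^14 * (1 + 14 u + u^2)\<close>.
\<close>

definition exceptional_weights :: "nat \<Rightarrow> nat set" where
  "exceptional_weights d = (if d = 2 then {20, 76} else if d = 3 \<or> d = 5 then {48} else {})"

lemma linear_power_16_expand:
  "[:-1, 1:] ^ 16 * [:1:]
     = ([:1, -16, 120, -560, 1820, -4368, 8008, -11440, 12870, -11440, 8008, -4368,
      1820, -560, 120, -16, 1:] :: real poly)"
  by (simp add: power_numeral_reduce one_pCons)

lemma signed_factor_expand_2:
  "[:-1, 1:] ^ (16 - 2) * signed_factor 2
     = ([:1, 0, -104, 896, -4004, 11648, -24024, 36608, -42042, 36608, -24024, 11648,
      -4004, 896, -104, 0, 1:] :: real poly)"
  by (simp add: signed_factor_def power_numeral_reduce one_pCons)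

lemma signed_factor_expand_3:
  "[:-1, 1:] ^ (16 - 3) * signed_factor 3
     = ([:-1, 46, -474, 2430, -7566, 15366, -20306, 15158, 0, -15158, 20306, -15366,
      7566, -2430, 474, -46, 1:] :: real poly)"
  by (simp add: signed_factor_def power_numeral_reduce one_pCons)

lemma signed_factor_expand_4:
  "[:-1, 1:] ^ (16 - 4) * signed_factor 4
     = ([:1, 16, -72, -720, 7068, -28656, 70664, -118096, 139590, -118096, 70664,
      -28656, 7068, -720, -72, 16, 1:] :: real poly)"
  by (simp add: signed_factor_def power_numeral_reduce one_pCons)

lemma signed_factor_expand_5:
  "[:-1, 1:] ^ (16 - 5) * signed_factor 5
     = ([:-1, 30, 230, -3730, 18290, -47818, 73326, -59290, 0, 59290, -73326, 47818,
      -18290, 3730, -230, -30, 1:] :: real poly)"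
  by (simp add: signed_factor_def power_numeral_reduce one_pCons)

text \<open>
  A few integer values of \<open>y\<close> already give a linear system of full rank \<open>d\<close> (of rank \<open>2\<close>
  for \<open>d = 1\<close>) in the \<open>d + 1\<close> coefficients.
\<close>

lemma reduced_invariant_1:
  fixes q :: "real poly"
  assumes "reduced_invariant 1 q"
  shows "q = 0"
proof -
  note deg = reduced_invariantD(1) [OF assms] and E = reduced_invariantD(2) [OF assms]
  have S: "{..1} = {0, 1::nat}" by auto
  have c: "coeff q 0 = 0" "coeff q 1 = 0"
    using E [of 2] E [of "-2"] by (simp_all add: S)
  show ?thesis
    by (rule poly_ext)
       (simp add: poly_eq_sum_atMost [OF deg] S c algebra_simps power_numeral_reduce del: One_nat_def)
qed

lemma reduced_invariant_2:
  fixes q :: "real poly"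
  assumes "reduced_invariant 2 q"
  shows "q = smult (coeff q 0) [:1, 14, 1:]"
proof -
  note deg = reduced_invariantD(1) [OF assms] and E = reduced_invariantD(2) [OF assms]
  have S: "{..2} = {0, 1, 2::nat}" by auto
  have c: "coeff q 1 = 14 * coeff q 0" "coeff q 2 = 1 * coeff q 0"
    using E [of 2] E [of "-2"] by (simp_all add: S)
  show ?thesis
    by (rule poly_ext)
       (simp add: poly_eq_sum_atMost [OF deg] S c algebra_simps power_numeral_reduce del: One_nat_def)
qed

lemma reduced_invariant_3:
  fixes q :: "real poly"
  assumes "reduced_invariant 3 q"
  shows "q = smult (coeff q 0) [:1, -33, -33, 1:]"
proof -
  note deg = reduced_invariantD(1) [OF assms] and E = reduced_invariantD(2) [OF assms]
  have S: "{..3} = {0, 1, 2, 3::nat}" by auto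
  have c: "coeff q 1 = -33 * coeff q 0" "coeff q 2 = -33 * coeff q 0" "coeff q 3 = 1 * coeff q 0"
    using E [of 2] E [of "-2"] E [of 3] by (simp_all add: S)
  show ?thesis
    by (rule poly_ext)
       (simp add: poly_eq_sum_atMost [OF deg] S c algebra_simps power_numeral_reduce del: One_nat_def)
qed

lemma reduced_invariant_4:
  fixes q :: "real poly"
  assumes "reduced_invariant 4 q"
  shows "q = smult (coeff q 0) [:1, 28, 198, 28, 1:]"
proof -
  note deg = reduced_invariantD(1) [OF assms] and E = reduced_invariantD(2) [OF assms]
  have S: "{..4} = {0, 1, 2, 3, 4::nat}" by auto
  have c: "coeff q 1 = 28 * coeff q 0" "coeff q 2 = 198 * coeff q 0" "coeff q 3 = 28 * coeff q 0" "coeff q 4 = 1 * coeff q 0"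
    using E [of 2] E [of "-2"] E [of 3] E [of 4] by (simp_all add: S)
  show ?thesis
    by (rule poly_ext)
       (simp add: poly_eq_sum_atMost [OF deg] S c algebra_simps power_numeral_reduce del: One_nat_def)
qed

lemma reduced_invariant_5:
  fixes q :: "real poly"
  assumes "reduced_invariant 5 q"
  shows "q = smult (coeff q 0) [:1, -19, -494, -494, -19, 1:]"
proof -
  note deg = reduced_invariantD(1) [OF assms] and E = reduced_invariantD(2) [OF assms]
  have S: "{..5} = {0, 1, 2, 3, 4, 5::nat}" by auto
  have c: "coeff q 1 = -19 * coeff q 0" "coeff q 2 = -494 * coeff q 0"
      "coeff q 3 = -494 * coeff q 0" "coeff q 4 = -19 * coeff q 0" "coeff q 5 = 1 * coeff q 0"
    using E [of 2] E [of "-2"] E [of 3] E [of 4] E [of "-4"] by (simp_all add: S)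
  show ?thesis
    by (rule poly_ext)
       (simp add: poly_eq_sum_atMost [OF deg] S c algebra_simps power_numeral_reduce del: One_nat_def)
qed

lemma reduced_invariant_eq:
  assumes "reduced_invariant d q" and "1 \<le> d" "d \<le> 5"
  shows "q = smult (coeff q 0) (signed_factor d)"
proof -
  consider "d = 1" | "d = 2" | "d = 3" | "d = 4" | "d = 5"
    using assms(2,3) by linarith
  then show ?thesis
    by cases (use assms(1) reduced_invariant_1 reduced_invariant_2 reduced_invariant_3
                reduced_invariant_4 reduced_invariant_5 in \<open>simp_all add: signed_factor_def\<close>)
qed

lemma coeff_signed_factor_nonzero:
  assumes "2 \<le> d" "d \<le> 5" and "j \<le> 16" and "16 + 4 * j \<notin> exceptional_weights d"
  shows "coeff ([:-1, 1:] ^ (16 - d) * signed_factor d) j \<noteq> 0"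
proof -
  have d: "d \<in> {2, 3, 4, 5}"
    using assms by auto
  have "j \<in> {0, 1, 2, 3, 4, 5, 6, 7, 8, 9, 10, 11, 12, 13, 14, 15, 16}"
    using assms(3) by auto presburger
  note j = this assms(4)
  from d consider "d = 2" | "d = 3" | "d = 4" | "d = 5" by auto
  then show ?thesis
  proof cases
    case 1
    show ?thesis
      using j unfolding 1 signed_factor_expand_2 by (auto simp: exceptional_weights_def coeff_pCons)
  next
    case 2
    show ?thesis
      using j unfolding 2 signed_factor_expand_3 by (auto simp: exceptional_weights_def coeff_pCons)
  next
    case 3
    show ?thesis
      using j unfolding 3 signed_factor_expand_4 by (auto simp: exceptional_weights_def coeff_pCons)
  next
    case 4
    show ?thesis
      using j unfolding 4 signed_factor_expand_5 by (auto simp: exceptional_weights_def coeff_pCons)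
  qed
qed

section \<open>From codes to invariant polynomials\<close>

definition shell_blocks :: "(bit ^ 'n::finite) set \<Rightarrow> nat \<Rightarrow> 'n set set" where
  "shell_blocks C l = supp ` words_of_weight C l"

lemma inj_supp: "inj_on supp A"
  by (rule inj_onI) (auto simp: supp_def vec_eq_iff set_eq_iff, metis bit_not_one_iff)

lemma pair_sum_shell_blocks:
  "pair_sum (shell_blocks C l) P {} = (\<Sum>c\<in>words_of_weight C l. pair_sign P (supp c))"
  unfolding pair_sum_def shell_blocks_def by (subst sum.reindex [OF inj_supp]) simp

lemma uniform_shell_blocks: "uniform_blocks l (shell_blocks C l)"
  by (auto simp: uniform_blocks_def shell_blocks_def words_of_weight_def wt_def)

lemma words_design_iff: "words_design t (words_of_weight C l) \<longleftrightarrow> comb_design t UNIV (shell_blocks C l)"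
  by (simp add: words_design_def shell_blocks_def)

lemma wt_eq_0_iff: "wt c = 0 \<longleftrightarrow> c = 0" for c :: "bit ^ 'n::finite"
  by (auto simp: wt_def supp_def vec_eq_iff)

lemma wt_complement: "wt (1 + c) = CARD('n) - wt c" for c :: "bit ^ 'n::finite"
proof -
  have "supp (1 + c) = - supp c"
    by (auto simp: supp_def)
  then show ?thesis
    by (simp add: wt_def Compl_eq_Diff_UNIV card_Diff_subset)
qed

text \<open>
  A word has even weight exactly when it is orthogonal to the all-one word.
\<close>

lemma one_in_doubly_even:
  fixes C :: "(bit ^ 'n::finite) set"
  assumes "self_dual C" and "doubly_even C"
  shows "1 \<in> C"
proof -
  have "bilin 1 c = 0" if "c \<in> C" for c
  proof -
    have "bilin 1 c = (\<Sum>i\<in>UNIV. if i \<in> supp c then 1 else 0)"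
      unfolding bilin_def by (intro sum.cong) (auto simp: supp_def)
    also have "\<dots> = of_nat (wt c)"
      by (simp add: sum.If_cases wt_def)
    also have "\<dots> = 0"
      using assms(2) that by (auto simp: doubly_even_def elim!: dvdE)
    finally show ?thesis .
  qed
  then have "1 \<in> dual_code C"
    by (simp add: dual_code_def)
  with assms(1) show ?thesis by (simp add: self_dual_def)
qed

lemma sum_over_shells:
  fixes C :: "(bit ^ 'n::finite) set" and h :: "nat \<Rightarrow> real"
  assumes "\<And>c. c \<in> C \<Longrightarrow> pair_sign P (supp c) \<noteq> 0 \<Longrightarrow> \<exists>j\<le>b. wt c = a + 4 * j"
  shows "(\<Sum>c\<in>C. pair_sign P (supp c) * h (wt c))
    = (\<Sum>j\<le>b. pair_sum (shell_blocks C (a + 4 * j)) P {} * h (a + 4 * j))"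
proof -
  have "(\<Sum>c\<in>C. pair_sign P (supp c) * h (wt c))
      = (\<Sum>c\<in>C. \<Sum>j\<le>b. if wt c = a + 4 * j then pair_sign P (supp c) * h (a + 4 * j) else 0)"
  proof (intro sum.cong refl)
    fix c assume "c \<in> C"
    show "pair_sign P (supp c) * h (wt c)
        = (\<Sum>j\<le>b. if wt c = a + 4 * j then pair_sign P (supp c) * h (a + 4 * j) else 0)"
    proof (cases "pair_sign P (supp c) = 0")
      case False
      then obtain k where "k \<le> b" "wt c = a + 4 * k"
        using assms \<open>c \<in> C\<close> by blast
      then show ?thesis by simp
    next
      case True
      then show ?thesis by (simp cong: if_cong)
    qed
  qed
  also have "\<dots> = (\<Sum>j\<le>b. \<Sum>c\<in>C. if wt c = a + 4 * j then pair_sign P (supp c) * h (a + 4 * j) else 0)"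
    by (rule sum.swap)
  also have "\<dots> = (\<Sum>j\<le>b. pair_sum (shell_blocks C (a + 4 * j)) P {} * h (a + 4 * j))"
    by (auto simp: pair_sum_shell_blocks words_of_weight_def sum.inter_filter sum_distrib_right
             intro!: sum.cong)
  finally show ?thesis .
qed

lemma coeff_sum_monom: "coeff (\<Sum>j\<le>b. monom (s j) j) i = (if i \<le> b then s i else (0::'a::comm_ring_1))"
  by (simp add: coeff_sum)

lemma degree_sum_monom: "degree (\<Sum>j\<le>b. monom (s j :: 'a::comm_ring_1) j) \<le> b"
  by (rule degree_le) (simp add: coeff_sum_monom)

text \<open>
  Serves two cases: \<open>a = 16\<close>, \<open>e = d \<ge> 1\<close> for signed sums, where \<open>0\<close> and the all-one word
  do not contribute, and \<open>a = d = m = 0\<close>, \<open>b = e = 24\<close> for the ordinary weight enumerator.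
\<close>

lemma invariant_poly_shells:
  fixes C :: "(bit ^ 'n::finite) set"
  assumes "self_dual C" and n: "CARD('n) = 2 * a + 4 * b"
    and P: "disjoint_pairs P" "length P = d"
    and ab: "a = m + d" "b = m + e"
    and factor: "(-2) ^ d * (8 ^ m * (-4) ^ e) = real (card C)"
    and wts: "\<And>c. c \<in> C \<Longrightarrow> pair_sign P (supp c) \<noteq> 0 \<Longrightarrow> \<exists>j\<le>b. wt c = a + 4 * j"
  shows "invariant_poly m e (\<Sum>j\<le>b. monom (pair_sum (shell_blocks C (a + 4 * j)) P {}) j)"
proof -
  let ?s = "\<lambda>j. pair_sum (shell_blocks C (a + 4 * j)) P {}"
  let ?g = "\<Sum>j\<le>b. monom (?s j) j"
  have deg: "degree ?g \<le> b"
    by (rule degree_sum_monom)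
  have "(1 - y\<^sup>2) ^ m * (\<Sum>j\<le>m + e. coeff ?g j * (1 - y) ^ (4 * j) * (1 + y) ^ (4 * (m + e - j)))
      = 8 ^ m * (-4) ^ e * y ^ m * poly ?g (y ^ 4)" for y :: real
  proof -
    have split: "1 - y\<^sup>2 = (1 - y) * (1 + y)"
      by (simp add: algebra_simps power2_eq_square)
    have "(-2) ^ d * ((1 - y\<^sup>2) ^ m * (\<Sum>j\<le>m + e. coeff ?g j * (1 - y) ^ (4 * j) * (1 + y) ^ (4 * (m + e - j))))
        = (-2) ^ d * (\<Sum>j\<le>b. ?s j * ((1 - y) ^ (a + 4 * j - d) * (1 + y) ^ (CARD('n) - d - (a + 4 * j))))"
    proof -
      have "(1 - y\<^sup>2) ^ m * (coeff ?g j * (1 - y) ^ (4 * j) * (1 + y) ^ (4 * (m + e - j)))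
          = ?s j * ((1 - y) ^ (a + 4 * j - d) * (1 + y) ^ (CARD('n) - d - (a + 4 * j)))" if "j \<le> b" for j
      proof -
        have "a + 4 * j - d = m + 4 * j" "CARD('n) - d - (a + 4 * j) = m + 4 * (m + e - j)"
          using that n ab by simp_all
        then show ?thesis
          using that by (simp add: coeff_sum_monom split power_mult_distrib power_add mult_ac)
      qed
      then show ?thesis
        by (simp add: ab(2) sum_distrib_left)
    qed
    also have "\<dots> = (-2) ^ d * (\<Sum>c\<in>C. pair_sign P (supp c) *
        ((1 - y) ^ (wt c - d) * (1 + y) ^ (CARD('n) - d - wt c)))"
      using sum_over_shells [OF wts, where h = "\<lambda>l. (1 - y) ^ (l - d) * (1 + y) ^ (CARD('n) - d - l)"]
      by simp
    also have "\<dots> = card C * (\<Sum>c\<in>C. pair_sign P (supp c) * y ^ (wt c - d))"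
      by (rule macwilliams_pairs [OF assms(1) P])
    also have "(\<Sum>c\<in>C. pair_sign P (supp c) * y ^ (wt c - d)) = (\<Sum>j\<le>b. ?s j * y ^ (a + 4 * j - d))"
      by (rule sum_over_shells [OF wts, where h = "\<lambda>l. y ^ (l - d)"])
    also have "\<dots> = y ^ m * poly ?g (y ^ 4)"
      by (simp add: poly_sum poly_monom sum_distrib_left ab(1) power_add mult_ac flip: power_mult)
    finally show ?thesis
      by (simp add: factor [symmetric])
  qed
  then show ?thesis
    using deg by (simp add: invariant_poly_def ab(2))
qed

section \<open>An explicit invariant of degree 96\<close>

text \<open>
  In \<open>u = y^4\<close>, the weight enumerator that a doubly even self-dual code of length \<open>96\<close> and
  minimum weight \<open>20\<close> would have.
\<close>

definition extremal_enumerator :: "real poly" where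
  "extremal_enumerator = [:1, 0, 0, 0, 0, 3217056, 369844880, 18642839520, 422069980215, 4552866656416,
      24292689565680, 65727011639520, 91447669224080, 65727011639520, 24292689565680,
      4552866656416, 422069980215, 18642839520, 369844880, 3217056, 0, 0, 0, 0, 1:]"

text \<open>
  The expansion in the Gleason generators \<open>1 + 14 u + u^2\<close> and \<open>u (1 - u)^4\<close>, with
  coefficients chosen to annihilate the coefficients of \<open>u, \<dots>, u^4\<close>. It makes the
  invariance evident.
\<close>

lemma extremal_enumerator_gleason:
  "extremal_enumerator =
     [:1, 14, 1:] ^ 12 - 168 * [:1, 14, 1:] ^ 9 * [:0, 1, -4, 6, -4, 1:]
     + 7548 * [:1, 14, 1:] ^ 6 * [:0, 1, -4, 6, -4, 1:] ^ 2
     - 75920 * [:1, 14, 1:] ^ 3 * [:0, 1, -4, 6, -4, 1:] ^ 3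
     + 28086 * [:0, 1, -4, 6, -4, 1:] ^ 4"
  by (simp add: extremal_enumerator_def power_numeral_reduce one_pCons numeral_poly)

lemma invariant_extremal_enumerator: "invariant_poly 0 24 extremal_enumerator"
proof -
  have deg: "degree extremal_enumerator \<le> 24"
    by (simp add: extremal_enumerator_def)
  have "(\<Sum>j\<le>24. coeff extremal_enumerator j * (1 - y) ^ (4 * j) * (1 + y) ^ (4 * (24 - j)))
      = (-4) ^ 24 * poly extremal_enumerator (y ^ 4)" for y :: real
  \<comment> \<open>At \<open>y = -1\<close> the substitution is undefined and only the leading term survives.\<close>
  proof (cases "y = -1")
    case True
    have "{..24::nat} = insert 24 {..<24}" by auto
    moreover have "(\<Sum>j<24. coeff extremal_enumerator j * (1 - y) ^ (4 * j) * (1 + y) ^ (4 * (24 - j))) = 0"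
      by (rule sum.neutral) (simp add: True power_0_left)
    ultimately show ?thesis
      by (simp add: True) (simp add: extremal_enumerator_def numeral_eq_Suc)
  next
    case False
    define x where "x = ((1 - y) / (1 + y)) ^ 4"
    have nz: "1 + y \<noteq> 0" using False by simp
    have xy: "(1 + y) ^ 4 * x = (1 - y) ^ 4"
      using nz by (simp add: x_def power_divide)
    have "(1 + y) ^ 8 * poly [:1, 14, 1:] x
        = ((1 + y) ^ 4)\<^sup>2 + 14 * (1 + y) ^ 4 * ((1 + y) ^ 4 * x) + ((1 + y) ^ 4 * x)\<^sup>2"
      by (simp add: algebra_simps power_numeral_reduce)
    also have "\<dots> = 16 * poly [:1, 14, 1:] (y ^ 4)"
      unfolding xy by (simp add: algebra_simps power_numeral_reduce)
    finally have W8: "(1 + y) ^ 8 * poly [:1, 14, 1:] x = 16 * poly [:1, 14, 1:] (y ^ 4)" .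
    have delta: "poly [:0, 1, -4, 6, -4, 1:] z = z * (1 - z) ^ 4" for z :: real
      by (simp add: algebra_simps power_numeral_reduce)
    have x1: "(1 + y) ^ 4 * (1 - x) = 8 * y * (1 + y\<^sup>2)"
      unfolding right_diff_distrib xy by (simp add: algebra_simps power_numeral_reduce)
    have "(1 + y) ^ 24 = (1 + y) ^ 4 * ((1 + y) ^ 4) ^ 4 * (1 + y) ^ 4"
      by (simp flip: power_mult power_add)
    then have "(1 + y) ^ 24 * poly [:0, 1, -4, 6, -4, 1:] x
        = ((1 + y) ^ 4 * x) * ((1 + y) ^ 4 * (1 - x)) ^ 4 * (1 + y) ^ 4"
      unfolding delta by (simp add: power_mult_distrib mult_ac)
    also have "\<dots> = 4096 * (y * ((1 - y) * (1 + y) * (1 + y\<^sup>2))) ^ 4"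
    proof -
      have "s ^ 4 * (8 * y * t) ^ 4 * r ^ 4 = 4096 * (y * (s * r * t)) ^ 4" for r s t :: real
        by (simp add: power_mult_distrib mult_ac)
      then show ?thesis
        unfolding xy x1 .
    qed
    also have "(1 - y) * (1 + y) * (1 + y\<^sup>2) = 1 - y ^ 4"
      by (simp add: algebra_simps power_numeral_reduce)
    finally have W24: "(1 + y) ^ 24 * poly [:0, 1, -4, 6, -4, 1:] x
        = 4096 * poly [:0, 1, -4, 6, -4, 1:] (y ^ 4)"
      unfolding delta by (simp add: power_mult_distrib)
    \<comment> \<open>Weighted homogeneity, for \<open>v = (1 + y) ^ 8\<close> on one side of the invariance and \<open>v = 16\<close> on the other.\<close>
    have gleason: "v ^ 12 * poly extremal_enumerator z =
        (v * poly [:1, 14, 1:] z) ^ 12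
        - 168 * (v * poly [:1, 14, 1:] z) ^ 9 * (v ^ 3 * poly [:0, 1, -4, 6, -4, 1:] z)
        + 7548 * (v * poly [:1, 14, 1:] z) ^ 6 * (v ^ 3 * poly [:0, 1, -4, 6, -4, 1:] z) ^ 2
        - 75920 * (v * poly [:1, 14, 1:] z) ^ 3 * (v ^ 3 * poly [:0, 1, -4, 6, -4, 1:] z) ^ 3
        + 28086 * (v ^ 3 * poly [:0, 1, -4, 6, -4, 1:] z) ^ 4" for v z :: real
    proof -
      have "v ^ 12 * (p ^ 12 - 168 * p ^ 9 * q + 7548 * p ^ 6 * q ^ 2 - 75920 * p ^ 3 * q ^ 3 + 28086 * q ^ 4)
        = (v * p) ^ 12 - 168 * (v * p) ^ 9 * (v ^ 3 * q) + 7548 * (v * p) ^ 6 * (v ^ 3 * q) ^ 2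
          - 75920 * (v * p) ^ 3 * (v ^ 3 * q) ^ 3 + 28086 * (v ^ 3 * q) ^ 4" for p q :: real
        by (simp add: algebra_simps power_numeral_reduce)
      then show ?thesis
        unfolding extremal_enumerator_gleason poly_add poly_diff poly_mult poly_power poly_numeral .
    qed
    have "(1 + y) ^ 96 * poly extremal_enumerator x = 16 ^ 12 * poly extremal_enumerator (y ^ 4)"
      using gleason [of "(1 + y) ^ 8" x] gleason [of 16 "y ^ 4"] W8 W24
      by (simp flip: power_mult del: poly_pCons)
    then show ?thesis
      using homogeneous_eval [OF deg nz] by (simp add: x_def)
  qed
  then show ?thesis
    using deg by (simp add: invariant_poly_def)
qed

section \<open>Near-extremal codes of length 96\<close>

locale near_extremal_code =
  fixes C :: "(bit ^ 'n::finite) set"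
  assumes code_length: "CARD('n) = 96"
    and self_dual: "self_dual C" and doubly_even: "doubly_even C"
    and min_weight: "min_weight C = 16"
begin

abbreviation "blocks \<equiv> shell_blocks C"

lemma card_code: "card C = 2 ^ 48"
proof -
  have "card C ^ 2 = (2 ^ 48) ^ 2"
    using card_self_dual [OF self_dual] code_length by simp
  then show ?thesis
    by (simp only: power_eq_iff_eq_base zero_le zero_less_numeral)
qed

lemma zero_in_code: "0 \<in> C"
  using self_dual by (auto simp: self_dual_def vec.subspace_0)

lemma one_in_code: "1 \<in> C"
  using one_in_doubly_even [OF self_dual doubly_even] .

text \<open>
  The upper bound \<open>80\<close> comes from the complementary word, which has weight at least \<open>16\<close>
  or is \<open>0\<close>.
\<close>

lemma weights:
  assumes "c \<in> C"
  shows "c = 0 \<or> supp c = UNIV \<or> (\<exists>j\<le>16. wt c = 16 + 4 * j)"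
proof -
  have min: "16 \<le> wt x" if "x \<in> C" "x \<noteq> 0" for x
    using that min_weight unfolding min_weight_def by (metis Diff_iff Min_le finite finite_imageI imageI singletonD)
  have "1 + c \<in> C"
    using self_dual assms one_in_code by (auto simp: self_dual_def intro: vec.subspace_add)
  moreover have compl: "wt (1 + c) = 96 - wt c"
    using wt_complement [of c] by (simp only: code_length)
  ultimately have "1 + c = 0 \<or> wt c \<le> 80"
    using min [of "1 + c"] by (cases "1 + c = 0") auto
  moreover have "supp c = UNIV" if "1 + c = 0"
  proof -
    have "supp (1 + c) = - supp c"
      by (auto simp: supp_def)
    with that show ?thesis by (auto simp: supp_def)
  qed
  moreover have "4 dvd wt c"
    using doubly_even assms by (simp add: doubly_even_def)
  then obtain k where "wt c = 4 * k" by (elim dvdE)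
  then have "\<exists>j\<le>16. wt c = 16 + 4 * j" if "16 \<le> wt c" "wt c \<le> 80"
    using that by (intro exI [of _ "k - 4"]) auto
  ultimately show ?thesis
    using min [OF assms] by blast
qed

lemma minimum_word: "words_of_weight C 16 \<noteq> {}"
proof -
  have "C - {0} \<noteq> {}"
  proof
    assume "C - {0} = {}"
    then have "card C \<le> card {0 :: bit ^ 'n}"
      by (intro card_mono) auto
    then show False by (simp add: card_code)
  qed
  then have "Min (wt ` (C - {0})) \<in> wt ` (C - {0})"
    by (intro Min_in) auto
  then show ?thesis
    using min_weight by (auto simp: min_weight_def words_of_weight_def)
qed

lemma pair_sign_empty:
  "P \<noteq> [] \<Longrightarrow> pair_sign P {} = 0"
  "P \<noteq> [] \<Longrightarrow> pair_sign P UNIV = 0"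
  for P :: "('n \<times> 'n) list"
  by (cases P; force simp: pair_sign_def)+

lemma weights_of_signed_words:
  assumes "P \<noteq> []" and "c \<in> C" and "pair_sign P (supp c) \<noteq> 0"
  shows "\<exists>j\<le>16. wt c = 16 + 4 * j"
  using weights [OF assms(2)]
proof (elim disjE)
  assume "c = 0"
  then have "supp c = {}" by (simp add: supp_def)
  with assms show ?thesis by (simp add: pair_sign_empty)
qed (use assms in \<open>auto simp: pair_sign_empty\<close>)

lemma pair_sum_outside:
  assumes "P \<noteq> []" and "\<nexists>j. j \<le> 16 \<and> l = 16 + 4 * j"
  shows "pair_sum (blocks l) P {} = 0"
  unfolding pair_sum_shell_blocks
  using weights_of_signed_words [OF assms(1)] assms(2)
  by (intro sum.neutral) (auto simp: words_of_weight_def)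

text \<open>
  The signed sums of all shells are governed by the single number \<open>a\<close>.
\<close>

lemma signed_enumerator:
  assumes P: "disjoint_pairs P" "length P = d" and d: "1 \<le> d" "d \<le> 5"
  shows "\<exists>a. \<forall>j\<le>16.
    pair_sum (blocks (16 + 4 * j)) P {} = a * coeff ([:-1, 1:] ^ (16 - d) * signed_factor d) j"
proof -
  have "d \<in> {1, 2, 3, 4, 5}"
    using d by auto
  then have factor: "(-2) ^ d * (8 ^ (16 - d) * (-4) ^ d) = real (card C)"
    by (auto simp: card_code)
  have "P \<noteq> []" using P(2) d by auto
  let ?g = "\<Sum>j\<le>16. monom (pair_sum (blocks (16 + 4 * j)) P {}) j"
  have "invariant_poly (16 - d) d ?g"
    using weights_of_signed_words [OF \<open>P \<noteq> []\<close>] d factor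
    by (intro invariant_poly_shells [OF self_dual _ P]) (auto simp: code_length)
  then obtain q where q: "?g = [:-1, 1:] ^ (16 - d) * q" "reduced_invariant d q"
    by (rule invariant_poly_quotient)
  have "pair_sum (blocks (16 + 4 * j)) P {}
      = coeff q 0 * coeff ([:-1, 1:] ^ (16 - d) * signed_factor d) j" if "j \<le> 16" for j
  proof -
    have "pair_sum (blocks (16 + 4 * j)) P {} = coeff ?g j"
      using that by (simp add: coeff_sum_monom)
    also have "\<dots> = coeff ([:-1, 1:] ^ (16 - d) * smult (coeff q 0) (signed_factor d)) j"
      unfolding q(1) by (subst reduced_invariant_eq [OF q(2) d]) (rule refl)
    finally show ?thesis by simp
  qed
  then show ?thesis by blast
qed

lemma pair_sum_eq_0I:
  assumes "P \<noteq> []"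
    and "\<And>j. j \<le> 16 \<Longrightarrow> pair_sum (blocks (16 + 4 * j)) P {} = 0"
  shows "pair_sum (blocks l) P {} = 0"
  using assms pair_sum_outside [OF assms(1), of l]
  by (cases "\<exists>j. j \<le> 16 \<and> l = 16 + 4 * j") auto

text \<open>
  At a weight that is not exceptional, a vanishing sum forces \<open>a = 0\<close> in
  \<open>signed_enumerator\<close>.
\<close>

lemma pair_sum_vanishes_everywhere:
  assumes P: "disjoint_pairs P" "length P = d" and d: "1 \<le> d" "d \<le> 5"
    and l: "l \<in> weights_L" "l \<notin> exceptional_weights d"
    and zero: "pair_sum (blocks l) P {} = 0"
  shows "pair_sum (blocks l') P {} = 0"
proof -
  obtain a where a: "\<And>j. j \<le> 16 \<Longrightarrow>
      pair_sum (blocks (16 + 4 * j)) P {} = a * coeff ([:-1, 1:] ^ (16 - d) * signed_factor d) j"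
    using signed_enumerator [OF P d] by blast
  obtain j where j: "j \<le> 16" "l = 16 + 4 * j"
  proof -
    have "4 dvd l" "16 \<le> l" "l \<le> 80" using l(1) by (auto simp: weights_L_def)
    then obtain k where "l = 4 * k" by (elim dvdE)
    with \<open>16 \<le> l\<close> \<open>l \<le> 80\<close> show thesis by (intro that [of "k - 4"]) auto
  qed
  have "a = 0 \<or> d = 1"
    using a [OF j(1)] zero j l(2) d coeff_signed_factor_nonzero [of d j] by force
  moreover have "signed_factor 1 = 0"
    by (simp add: signed_factor_def)
  moreover have "P \<noteq> []" using P(2) d by auto
  ultimately show ?thesis
    using a pair_sum_eq_0I [of P l'] by auto
qed

lemma pair_sum_single_pair:
  assumes P: "disjoint_pairs P" "length P = 1"
  shows "pair_sum (blocks l) P {} = 0"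
proof -
  obtain a where "\<And>j. j \<le> 16 \<Longrightarrow>
      pair_sum (blocks (16 + 4 * j)) P {} = a * coeff ([:-1, 1:] ^ (16 - 1) * signed_factor 1) j"
    using signed_enumerator [OF P] by force
  moreover have "signed_factor 1 = 0"
    by (simp add: signed_factor_def)
  moreover have "P \<noteq> []" using P(2) by auto
  ultimately show ?thesis
    using pair_sum_eq_0I [of P l] by simp
qed

text \<open>
  Signed sums over \<open>1, \<dots>, t\<close> pairs vanish on the given shell, hence on every shell.
\<close>

lemma comb_design_all_shells:
  assumes l: "l \<in> weights_L" and t: "t \<le> 5"
    and design: "comb_design t UNIV (blocks l)"
    and regular: "\<And>d. d \<le> t \<Longrightarrow> l \<notin> exceptional_weights d"
  shows "comb_design t UNIV (blocks l')"
proof -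
  have "t \<le> l" using l t by (simp add: weights_L_def)
  have "comb_design s UNIV (blocks l')" if "s \<le> t" for s
    using that
  proof (induction s)
    case 0
    show ?case
      by (rule comb_design_0 [OF uniform_shell_blocks])
  next
    case (Suc s)
    have "comb_design (Suc s) UNIV (blocks l)"
      using comb_design_down [OF uniform_shell_blocks design Suc.prems \<open>t \<le> l\<close>] .
    then have zero: "pair_sum (blocks l) P {} = 0" if "disjoint_pairs P" "length P = Suc s" for P
      using that by (intro comb_design_pair_sum_eq_0 [OF uniform_shell_blocks]) auto
    have vanish: "pair_sum (blocks l') P {} = 0"
      if P: "disjoint_pairs P" "length P = Suc s" for P
      using Suc.prems t
      by (intro pair_sum_vanishes_everywhere [OF P _ _ l regular [OF Suc.prems] zero [OF P]]) simp_all
    have "comb_design s UNIV (blocks l')"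
      using Suc by simp
    then show ?case
    proof (rule comb_design_SucI [OF uniform_shell_blocks])
      show "2 * Suc s \<le> CARD('n)"
        using Suc.prems t by (simp add: code_length)
    qed (rule vanish)
  qed
  then show ?thesis by simp
qed

lemma comb_design_1: "comb_design 1 UNIV (blocks l)"
proof -
  have "comb_design 0 UNIV (blocks l)"
    by (rule comb_design_0 [OF uniform_shell_blocks])
  then have "comb_design (Suc 0) UNIV (blocks l)"
  proof (rule comb_design_SucI [OF uniform_shell_blocks])
    show "2 * Suc 0 \<le> CARD('n)"
      by (simp add: code_length)
    show "pair_sum (blocks l) P {} = 0" if "disjoint_pairs P" "length P = Suc 0" for P
      using pair_sum_single_pair that by simp
  qed
  then show ?thesis by simp
qed

text \<open>
  After subtraction of \<open>extremal_enumerator\<close>, the constant term and the coefficients of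
  \<open>u, u^2, u^3\<close> vanish, and so do those of \<open>u^21, \<dots>, u^24\<close>. What remains is \<open>u^4 * g\<close> with
  \<open>g\<close> invariant for \<open>m = 16\<close>, \<open>d = 0\<close>; so \<open>g\<close> is a multiple of \<open>(u - 1)^16\<close>. The scalar is
  the coefficient \<open>A 16\<close> of \<open>u^4\<close>.
\<close>

lemma weight_enumerator:
  defines "A \<equiv> \<lambda>l. real (card (blocks l))"
  shows "A 20 = 3217056 - 16 * A 16" and "A 48 = 91447669224080 + 12870 * A 16"
    and "A 76 = 3217056 - 16 * A 16"
proof -
  define h where "h = (\<Sum>j\<le>24. monom (A (4 * j)) j)"
  define e where "e = h - extremal_enumerator"
  have A: "A l = pair_sum (blocks l) [] {}" for l
    by (simp add: A_def pair_sum_Nil)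
  have small: "wt c = 0 \<or> wt c = 96 \<or> (\<exists>j\<le>16. wt c = 16 + 4 * j)" if "c \<in> C" for c
    using weights [OF that] code_length by (auto simp: wt_def supp_def)
  have "\<exists>j\<le>24. wt c = 0 + 4 * j" if "c \<in> C" for c
    using small [OF that]
  proof (elim disjE exE conjE)
    fix j :: nat assume "j \<le> 16" "wt c = 16 + 4 * j"
    then show ?thesis by (intro exI [of _ "4 + j"]) auto
  qed auto
  then have "invariant_poly 0 24 h"
    unfolding h_def A
    using invariant_poly_shells [OF self_dual, of 0 24 "[]" 0 0 24] by (simp add: code_length card_code)
  then have inv: "(\<Sum>j\<le>24. coeff e j * (1 - y) ^ (4 * j) * (1 + y) ^ (4 * (24 - j)))
      = 4 ^ 24 * poly e (y ^ 4)" for y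
    using invariant_polyD [of 0 24 h y] invariant_polyD [OF invariant_extremal_enumerator, of y]
    by (simp add: e_def left_diff_distrib right_diff_distrib sum_subtractf)
  have A0: "A 0 = 1" "A 96 = 1"
  proof -
    have "words_of_weight C 0 = {0}"
      using zero_in_code by (auto simp: words_of_weight_def wt_eq_0_iff)
    then show "A 0 = 1"
      by (simp add: A_def shell_blocks_def)
    have "blocks 96 = {UNIV}"
    proof
      show "blocks 96 \<subseteq> {UNIV}"
        using card_eq_UNIV_imp_eq_UNIV [of "supp c" for c :: "bit ^ 'n"] code_length
        by (auto simp: shell_blocks_def words_of_weight_def wt_def)
      have supp_1: "UNIV = supp (1 :: bit ^ 'n)"
        by (simp add: supp_def)
      then have "1 \<in> words_of_weight C 96"
        using one_in_code code_length by (simp add: words_of_weight_def wt_def)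
      then have "supp 1 \<in> blocks 96"
        unfolding shell_blocks_def by (rule imageI)
      then show "{UNIV} \<subseteq> blocks 96"
        by (simp add: supp_1 [symmetric])
    qed
    then show "A 96 = 1"
      by (simp add: A_def)
  qed
  have A_empty: "A (4 * j) = 0" if "j \<in> {1, 2, 3, 21, 22, 23}" for j
  proof -
    have j: "0 < 4 * j" "4 * j < 96" "4 * j < 16 \<or> 80 < 4 * j"
      using that by auto
    have "wt c \<noteq> 4 * j" if "c \<in> C" for c
      using small [OF that] j by linarith
    then have "words_of_weight C (4 * j) = {}"
      by (auto simp: words_of_weight_def)
    then show ?thesis by (simp add: A_def shell_blocks_def)
  qed
  have coeff_h: "coeff h j = (if j \<le> 24 then A (4 * j) else 0)" for j
    by (simp add: h_def coeff_sum_monom)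
  have outside: "coeff e j = 0" if j: "j < 4 \<or> 20 < j" for j
  proof -
    consider "j = 0" | "j \<in> {1, 2, 3, 21, 22, 23}" | "j = 24" | "24 < j"
      using j by (simp, linarith)
    then show ?thesis
    proof cases
      case 2
      then have "coeff extremal_enumerator j = 0"
        by (auto simp: extremal_enumerator_def coeff_pCons)
      with 2 A_empty [OF 2] show ?thesis by (auto simp: e_def coeff_h)
    next
      case 4
      then have "coeff extremal_enumerator j = 0"
        by (intro coeff_eq_0) (simp add: extremal_enumerator_def)
      with 4 show ?thesis by (simp add: e_def coeff_h)
    qed (use A0 in \<open>simp_all add: e_def coeff_h extremal_enumerator_def coeff_pCons\<close>)
  qed
  define g where "g = (\<Sum>j\<le>16. monom (coeff e (4 + j)) j)"
  have coeff_g: "coeff g j = coeff e (4 + j)" for j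
    by (simp add: g_def coeff_sum_monom outside)
  have e: "e = monom 1 4 * g"
    by (rule poly_eqI) (simp add: coeff_monom_mult coeff_g outside)
  have "(1 - y\<^sup>2) ^ 16 * (\<Sum>j\<le>16. coeff g j * (1 - y) ^ (4 * j) * (1 + y) ^ (4 * (16 - j)))
      = 8 ^ 16 * y ^ 16 * poly g (y ^ 4)" for y :: real
  proof -
    have split: "1 - y\<^sup>2 = (1 - y) * (1 + y)"
      by (simp add: algebra_simps power2_eq_square)
    have "(\<Sum>j\<le>24. coeff e j * (1 - y) ^ (4 * j) * (1 + y) ^ (4 * (24 - j)))
        = (\<Sum>j\<in>(+) 4 ` {..16}. coeff e j * (1 - y) ^ (4 * j) * (1 + y) ^ (4 * (24 - j)))"
    proof (rule sum.mono_neutral_right)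
      show "\<forall>j\<in>{..24} - (+) 4 ` {..16}. coeff e j * (1 - y) ^ (4 * j) * (1 + y) ^ (4 * (24 - j)) = 0"
      proof
        fix j :: nat assume "j \<in> {..24} - (+) 4 ` {..16}"
        moreover have "j \<in> (+) 4 ` {..16}" if "4 \<le> j" "j \<le> 20"
          using that by (intro image_eqI [of _ _ "j - 4"]) auto
        ultimately have "j < 4 \<or> 20 < j" by force
        then show "coeff e j * (1 - y) ^ (4 * j) * (1 + y) ^ (4 * (24 - j)) = 0"
          by (simp add: outside)
      qed
    qed auto
    also have "\<dots> = (\<Sum>j\<le>16. coeff g j * (1 - y) ^ (4 * (4 + j)) * (1 + y) ^ (4 * (24 - (4 + j))))"
      by (subst sum.reindex) (auto simp: coeff_g)
    also have "\<dots> = (1 - y\<^sup>2) ^ 16 * (\<Sum>j\<le>16. coeff g j * (1 - y) ^ (4 * j) * (1 + y) ^ (4 * (16 - j)))"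
      unfolding sum_distrib_left
    proof (intro sum.cong refl)
      fix j :: nat assume "j \<in> {..16}"
      then have "4 * (4 + j) = 16 + 4 * j" "4 * (24 - (4 + j)) = 16 + 4 * (16 - j)"
        by auto
      then show "coeff g j * (1 - y) ^ (4 * (4 + j)) * (1 + y) ^ (4 * (24 - (4 + j)))
          = (1 - y\<^sup>2) ^ 16 * (coeff g j * (1 - y) ^ (4 * j) * (1 + y) ^ (4 * (16 - j)))"
        unfolding split by (simp only: power_add power_mult_distrib mult_ac)
    qed
    finally show ?thesis
      using inv [of y] by (simp add: e poly_monom flip: power_mult)
  qed
  then have "invariant_poly 16 0 g"
    using degree_sum_monom [of "\<lambda>j. coeff e (4 + j)" 16] by (simp add: invariant_poly_def g_def)
  then obtain q where q: "g = [:-1, 1:] ^ 16 * q" and "reduced_invariant 0 q"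
    by (rule invariant_poly_quotient)
  then have "degree q = 0"
    by (simp add: reduced_invariant_def)
  then obtain a where a: "q = [:a:]"
    using degree_eq_zeroE by blast
  have coeff: "A (16 + 4 * j) = coeff extremal_enumerator (4 + j) + a * coeff ([:-1, 1:] ^ 16 * [:1:]) j"
    if "j \<le> 16" for j
  proof -
    have "A (16 + 4 * j) = coeff h (4 + j)"
      using that by (simp add: coeff_h)
    also have "\<dots> = coeff extremal_enumerator (4 + j) + coeff g j"
      by (simp add: coeff_g e_def)
    finally show ?thesis
      by (simp add: q a)
  qed
  show "A 20 = 3217056 - 16 * A 16" and "A 48 = 91447669224080 + 12870 * A 16"
    and "A 76 = 3217056 - 16 * A 16"
    using coeff [of 0] coeff [of 1] coeff [of 8] coeff [of 15]
    unfolding linear_power_16_expand extremal_enumerator_def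
    by (simp_all add: coeff_pCons)
qed

section \<open>Bounds on the strength\<close>



lemma weight_counts:
  shows "0 < card (blocks 16)" and "card (blocks 16) \<le> 201066"
    and "card (blocks 20) \<le> 3217056" and "card (blocks 76) \<le> 3217056"
    and "card (blocks 48) = 91447669224080 + 12870 * card (blocks 16)"
proof -
  show "0 < card (blocks 16)"
    using minimum_word by (simp add: shell_blocks_def card_gt_0_iff)
  have "real (card (blocks 20) + 16 * card (blocks 16)) = real 3217056"
    and "real (card (blocks 76) + 16 * card (blocks 16)) = real 3217056"
    and "real (card (blocks 48)) = real (91447669224080 + 12870 * card (blocks 16))"
    using weight_enumerator by simp_all
  then have "card (blocks 20) + 16 * card (blocks 16) = 3217056"
    and "card (blocks 76) + 16 * card (blocks 16) = 3217056"
    and "card (blocks 48) = 91447669224080 + 12870 * card (blocks 16)"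
    unfolding of_nat_eq_iff by blast+
  then show "card (blocks 16) \<le> 201066" "card (blocks 20) \<le> 3217056" "card (blocks 76) \<le> 3217056"
    "card (blocks 48) = 91447669224080 + 12870 * card (blocks 16)"
    by linarith+
qed

text \<open>
  The number of blocks would be a positive multiple of \<open>1273418 = 2 * 19 * 23 * 31 * 47\<close>,
  which exceeds its bound \<open>201066\<close>.
\<close>

lemma not_5_design_16: "\<not> comb_design 5 UNIV (blocks 16)"
proof
  assume "comb_design 5 UNIV (blocks 16)"
  then have "(\<Prod>i<5. CARD('n) - i) dvd card (blocks 16) * (\<Prod>i<5. 16 - i)"
    by (intro comb_design_count [OF uniform_shell_blocks]) (simp_all add: code_length)
  moreover have "{..<5} = {0, 1, 2, 3, 4::nat}" by auto
  ultimately have "7334887680 dvd card (blocks 16) * 524160"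
    by (simp add: code_length)
  then have "1273418 dvd card (blocks 16)"
    by (rule dvd_of_bezout [where h = 5760 and u = 601725 and v = 43]) simp_all
  then show False
    using weight_counts(1,2) by (auto dest: dvd_imp_le)
qed

text \<open>
  For both weights \<open>20\<close> and \<open>76\<close>, the primes \<open>7, 13, 23, 31, 47\<close> and a power of \<open>2\<close> would
  have to divide the number of words, which is at most \<open>3217056\<close>.
\<close>

lemma not_6_design_20:
  assumes "words_of_weight C 20 \<noteq> {}"
  shows "\<not> comb_design 6 UNIV (blocks 20)"
proof
  have pos: "0 < card (blocks 20)"
    using assms by (simp add: shell_blocks_def card_gt_0_iff)
  assume "comb_design 6 UNIV (blocks 20)"
  then have "(\<Prod>i<6. CARD('n) - i) dvd card (blocks 20) * (\<Prod>i<6. 20 - i)"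
    by (intro comb_design_count [OF uniform_shell_blocks]) (simp_all add: code_length)
  moreover have "{..<6} = {0, 1, 2, 3, 4, 5::nat}" by auto
  ultimately have "667474778880 dvd card (blocks 20) * 27907200"
    by (simp add: code_length)
  then have "6099002 dvd card (blocks 20)"
    by (rule dvd_of_bezout [where h = 109440 and u = 3396307 and v = 142]) simp_all
  then show False
    using weight_counts(3) pos by (auto dest: dvd_imp_le)
qed

lemma not_6_design_76:
  assumes "words_of_weight C 76 \<noteq> {}"
  shows "\<not> comb_design 6 UNIV (blocks 76)"
proof
  have pos: "0 < card (blocks 76)"
    using assms by (simp add: shell_blocks_def card_gt_0_iff)
  assume "comb_design 6 UNIV (blocks 76)"
  then have "(\<Prod>i<6. CARD('n) - i) dvd card (blocks 76) * (\<Prod>i<6. 76 - i)"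
    by (intro comb_design_count [OF uniform_shell_blocks]) (simp_all add: code_length)
  moreover have "{..<6} = {0, 1, 2, 3, 4, 5::nat}" by auto
  ultimately have "667474778880 dvd card (blocks 76) * 157405636800"
    by (simp add: code_length)
  then have "12198004 dvd card (blocks 76)"
    by (rule dvd_of_bezout [where h = 54720 and u = 4399625 and v = 1037531]) simp_all
  then show False
    using weight_counts(4) pos by (auto dest: dvd_imp_le)
qed

text \<open>
  Strength \<open>6\<close> gives the prime \<open>7\<close> and strength \<open>8\<close> the primes \<open>19, 31, 89\<close> as divisors of
  \<open>A_48\<close>. As \<open>A_48\<close> is linear in \<open>A_16\<close>, this fixes \<open>A_16\<close> modulo
  \<open>366947 = 7 * 19 * 31 * 89\<close>, which exceeds the range of \<open>A_16\<close>. The remaining value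
  \<open>196726\<close> is not a multiple of \<open>6\<close>, as the \<open>1\<close>-design \<open>C_16\<close> demands.
\<close>

lemma not_8_design_48: "\<not> comb_design 8 UNIV (blocks 48)"
proof
  assume design: "comb_design 8 UNIV (blocks 48)"
  then have "comb_design 6 UNIV (blocks 48)"
    by (rule comb_design_down [OF uniform_shell_blocks]) simp_all
  then have "(\<Prod>i<6. CARD('n) - i) dvd card (blocks 48) * (\<Prod>i<6. 48 - i)"
    by (intro comb_design_count [OF uniform_shell_blocks]) (simp_all add: code_length)
  moreover have "{..<6} = {0, 1, 2, 3, 4, 5::nat}" by auto
  ultimately have "667474778880 dvd card (blocks 48) * 8835488640"
    by (simp add: code_length)
  then have "107198 dvd card (blocks 48)"
    by (rule dvd_of_bezout [where h = 6226560 and u = 87783 and v = 1162]) simp_all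
  then have seven: "7 dvd card (blocks 48)"
    by (rule dvd_trans [rotated]) simp
  have "(\<Prod>i<8. CARD('n) - i) dvd card (blocks 48) * (\<Prod>i<8. 48 - i)"
    using design by (intro comb_design_count [OF uniform_shell_blocks]) (simp_all add: code_length)
  moreover have "{..<8} = {0, 1, 2, 3, 4, 5, 6, 7::nat}" by auto
  ultimately have "5346472978828800 dvd card (blocks 48) * 15214711438080"
    by (simp add: code_length)
  then have "6814730 dvd card (blocks 48)"
    by (rule dvd_of_bezout [where h = 784546560 and u = 2972857 and v = 8460]) simp_all
  then have "52421 dvd card (blocks 48)"
    by (rule dvd_trans [rotated]) simp
  then obtain k where k: "card (blocks 48) = k * 52421"
    by (metis dvd_def mult.commute)
  have "7 dvd k"
    using seven unfolding k
    by (rule dvd_of_bezout [where h = 1 and u = 3 and v = 22466]) simp_all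
  then have "7 * 52421 dvd card (blocks 48)"
    unfolding k by (rule mult_dvd_mono) simp
  then have "366947 dvd 3621 * (91447669224080 + 12870 * card (blocks 16))"
    unfolding weight_counts(5) [symmetric] by (intro dvd_mult) simp
  \<comment> \<open>\<open>3621\<close> is the inverse of \<open>12870\<close> modulo \<open>366947\<close>, so the coefficient of \<open>card (blocks 16)\<close> becomes \<open>1\<close>.\<close>
  also have "3621 * (91447669224080 + 12870 * card (blocks 16))
      = (card (blocks 16) + 170221) + 366947 * (902397376897 + 127 * card (blocks 16))"
    by simp
  finally have "366947 dvd card (blocks 16) + 170221"
    by (metis dvd_add_left_iff dvd_triv_left)
  then obtain r where r: "card (blocks 16) + 170221 = 366947 * r"
    by (elim dvdE)
  with weight_counts(1,2) have "r < 2" "0 < r"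
    by linarith+
  then have "r = 1"
    by simp
  with r have count: "card (blocks 16) = 196726"
    by simp
  have "(\<Prod>i<1. CARD('n) - i) dvd card (blocks 16) * (\<Prod>i<1. 16 - i)"
    by (intro comb_design_count [OF uniform_shell_blocks comb_design_1]) (simp_all add: code_length)
  then have "96 dvd card (blocks 16) * 16"
    by (simp add: code_length)
  with count show False
    by simp
qed

lemma design_strength_bound:
  assumes l: "l \<in> weights_L" and nonempty: "words_of_weight C l \<noteq> {}"
    and "t \<le> l" and design: "comb_design t UNIV (blocks l)"
  shows "t \<le> (if l = 48 then 7 else if l = 20 \<or> l = 76 then 5 else 4)"
proof -
  have down: "comb_design s UNIV (blocks l)" if "s \<le> t" for s
    using comb_design_down [OF uniform_shell_blocks design that \<open>t \<le> l\<close>] .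
  consider "l = 48" | "l = 20" | "l = 76" | "l \<notin> {20, 48, 76}"
    by blast
  then show ?thesis
  proof cases
    case 1
    then have "\<not> 8 \<le> t"
      using down [of 8] not_8_design_48 by blast
    with 1 show ?thesis by simp
  next
    case 2
    then have "\<not> 6 \<le> t"
      using down [of 6] nonempty not_6_design_20 by blast
    with 2 show ?thesis by simp
  next
    case 3
    then have "\<not> 6 \<le> t"
      using down [of 6] nonempty not_6_design_76 by blast
    with 3 show ?thesis by simp
  next
    case 4
    have "\<not> 5 \<le> t"
    proof
      assume "5 \<le> t"
      have "l \<notin> exceptional_weights d" for d
        using 4 by (auto simp: exceptional_weights_def)
      then have "comb_design 5 UNIV (blocks 16)"
        by (intro comb_design_all_shells [OF l _ down [OF \<open>5 \<le> t\<close>]]) auto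
      then show False
        using not_5_design_16 by blast
    qed
    with 4 show ?thesis by simp
  qed
qed

end

theorem theorem1p4:
  fixes C :: "(bit ^ 'n::finite) set" and l t :: nat
  assumes "CARD('n) = 96"
    and "self_dual C" and "doubly_even C" and "min_weight C = 16"
    and "l \<in> weights_L"
    and "words_of_weight C l \<noteq> {}"
    and "1 \<le> t" and "t \<le> l"
    and "words_design t (words_of_weight C l)"
  shows "(t = 2 \<and> l \<noteq> 20 \<and> l \<noteq> 76 \<longrightarrow> (\<forall>S. is_shell C S \<longrightarrow> words_design 2 S)) \<and>
         (t \<ge> 3 \<and> l \<noteq> 20 \<and> l \<noteq> 48 \<and> l \<noteq> 76 \<longrightarrow> (\<forall>S. is_shell C S \<longrightarrow> words_design t S)) \<and>
         t \<le> (if l = 48 then 7 else if l = 20 \<or> l = 76 then 5 else 4)"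
proof -
  interpret near_extremal_code C
    by unfold_locales (use assms in simp_all)
  have design: "comb_design t UNIV (blocks l)"
    using assms(9) by (simp only: words_design_iff)
  have bound: "t \<le> (if l = 48 then 7 else if l = 20 \<or> l = 76 then 5 else 4)"
    using assms design by (intro design_strength_bound) auto
  have every: "words_design t S"
    if "is_shell C S" "t \<le> 5" "\<And>d. d \<le> t \<Longrightarrow> l \<notin> exceptional_weights d" for S
    using that comb_design_all_shells [OF assms(5) that(2) design that(3)]
    by (auto simp: is_shell_def words_design_iff)
  have "words_design 2 S" if "t = 2" "l \<noteq> 20" "l \<noteq> 76" "is_shell C S" for S
    using every [of S] that by (auto simp: exceptional_weights_def)
  moreover have "words_design t S" if "3 \<le> t" "l \<noteq> 20" "l \<noteq> 48" "l \<noteq> 76" "is_shell C S" for S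
    using every [of S] that bound by (auto simp: exceptional_weights_def)
  ultimately show ?thesis
    using bound by blast
qed

end
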